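(* Let $\Gamma\in(0,1)$ and let $\tau_1,\dots,\tau_n$ be strictly decreasing, continuous, surjective threshold functions on $[0,1]$. Suppose the arrival time distributions $\{\bar f_i(t,\Gamma)\}$ are well defined, i.e. $\int_0^1\bar f_i(t,\Gamma)\,dt\le 1$ for all $i\in[n]$. Then the algorithm that samples arrival times from $\{\bar f_i(t,\Gamma)\}$ and uses the thresholds $\{\tau_i\}$ satisfies, for all $x>0$, $$\mathbb{P}[\mathrm{ALG}>x]\ \ge\ \Gamma\cdot\mathbb{P}[\max_i v_i>x].$$
   Context: Setting: order selection prophet inequality with $n>1$ items having independent values $v_i\sim D_i$ (known distributions), where each $D_i$ is continuous and supported on a contiguous interval of reals with positive density throughout. For threshold functions $\tau_i:[0,1]\to\mathbb{R}$ define $\bar p_i(t)=\mathbb{P}[v_i>\tau_i(t)]$ and $\bar q_i(t)=\mathbb{P}[\max_{j\ne i}v_j>\tau_i(t)]$. The threshold function $\tau_i$ is called surjective if $\bar p_i(0)=\bar q_i(0)=0$ and $\bar p_i(1)=\bar q_i(1)=1$. Define $$\bar g(t,\Gamma)=1-\Gamma\sum_i\int_0^t\bar p_i(s)\bar q_i'(s)\,ds,\qquad \bar f_i(t,\Gamma)=\Gamma\frac{\bar q_i'(t)}{\bar g(t,\Gamma)}\exp\!\Big(-\Gamma\int_0^t\frac{\bar q_i'(s)\bar p_i(s)}{\bar g(s,\Gamma)}ds\Big).$$ The algorithm: independently for each item $i$, sample an arrival time $t_i\in[0,1]$ whose density on $[0,1)$ is $\bar f_i(t,\Gamma)$, with $t_i=1$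 with the remaining probability $1-\int_0^1\bar f_i(t,\Gamma)\,dt$; items arrive in increasing order of arrival time; the algorithm accepts the first item $i$ with $v_i>\tau_i(t_i)$, except that an item arriving at time $1$ is always rejected. $\mathrm{ALG}$ is the accepted value (0 if none).
   Formalization: The formal theorem additionally assumes that each q̄_i is absolutely continuous on [0,1], i.e. is the integral of its derivative; without this the claim fails, e.g. for two uniform values with τ_i = 1 − c, c a strictly increasing continuous singular function. *)

theory Defs
  imports "HOL-Probability.Probability"
begin

definition interval_density :: "'a measure \<Rightarrow> ('a \<Rightarrow> real) \<Rightarrow> bool" where
  "interval_density M X \<longleftrightarrow>
     (\<exists>d I. distributed M lborel X d \<and> is_interval I \<and>
            (\<forall>x\<in>I. d x > 0) \<and> (\<forall>x. x \<notin> I \<longrightarrow> d x = 0))"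

definition pbar :: "'a measure \<Rightarrow> (nat \<Rightarrow> 'a \<Rightarrow> real) \<Rightarrow> (nat \<Rightarrow> real \<Rightarrow> real) \<Rightarrow> nat \<Rightarrow> real \<Rightarrow> real" where
  "pbar M v \<tau> i t = measure M {\<omega> \<in> space M. v i \<omega> > \<tau> i t}"

definition qbar :: "'a measure \<Rightarrow> nat \<Rightarrow> (nat \<Rightarrow> 'a \<Rightarrow> real) \<Rightarrow> (nat \<Rightarrow> real \<Rightarrow> real) \<Rightarrow> nat \<Rightarrow> real \<Rightarrow> real" where
  "qbar M n v \<tau> i t =
     measure M {\<omega> \<in> space M. Max ((\<lambda>j. v j \<omega>) ` ({1..n} - {i})) > \<tau> i t}"

definition surjective_threshold ::
    "'a measure \<Rightarrow> nat \<Rightarrow> (nat \<Rightarrow> 'a \<Rightarrow> real) \<Rightarrow> (nat \<Rightarrow> real \<Rightarrow> real) \<Rightarrow> nat \<Rightarrow> bool" where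
  "surjective_threshold M n v \<tau> i \<longleftrightarrow>
     pbar M v \<tau> i 0 = 0 \<and> qbar M n v \<tau> i 0 = 0 \<and>
     pbar M v \<tau> i 1 = 1 \<and> qbar M n v \<tau> i 1 = 1"

(* Absolute continuity on [0,1], in the form given by Lebesgue's theorem. The values that
   deriv takes where f is not differentiable are immaterial: for a function with this
   property those points form a null set. *)
definition integral_of_deriv :: "(real \<Rightarrow> real) \<Rightarrow> bool" where
  "integral_of_deriv f \<longleftrightarrow>
     set_integrable lborel {0..1} (deriv f) \<and>
     (\<forall>t\<in>{0..1}. f t - f 0 = (LBINT s:{0..t}. deriv f s))"

definition gbar ::
    "'a measure \<Rightarrow> nat \<Rightarrow> (nat \<Rightarrow> 'a \<Rightarrow> real) \<Rightarrow> (nat \<Rightarrow> real \<Rightarrow> real) \<Rightarrow> real \<Rightarrow> real \<Rightarrow> real" where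
  "gbar M n v \<tau> \<Gamma> t =
     1 - \<Gamma> * (\<Sum>i\<in>{1..n}. LBINT s:{0..t}. pbar M v \<tau> i s * deriv (qbar M n v \<tau> i) s)"

definition fbar ::
    "'a measure \<Rightarrow> nat \<Rightarrow> (nat \<Rightarrow> 'a \<Rightarrow> real) \<Rightarrow> (nat \<Rightarrow> real \<Rightarrow> real) \<Rightarrow> real \<Rightarrow> nat \<Rightarrow> real \<Rightarrow> real" where
  "fbar M n v \<tau> \<Gamma> i t =
     \<Gamma> * (deriv (qbar M n v \<tau> i) t / gbar M n v \<tau> \<Gamma> t) *
     exp (- \<Gamma> * (LBINT s:{0..t}.
            deriv (qbar M n v \<tau> i) s * pbar M v \<tau> i s / gbar M n v \<tau> \<Gamma> s))"

(* X has density f on [0,1) and an atom at 1 carrying the remaining mass. The subtraction in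
   ennreal truncates, so this is a probability law only if f has total mass at most 1. *)
definition has_arrival_law :: "'a measure \<Rightarrow> ('a \<Rightarrow> real) \<Rightarrow> (real \<Rightarrow> real) \<Rightarrow> bool" where
  "has_arrival_law M X f \<longleftrightarrow>
     X \<in> borel_measurable M \<and> (\<forall>\<omega>\<in>space M. X \<omega> \<in> {0..1}) \<and>
     (\<forall>B\<in>sets borel. emeasure M {\<omega> \<in> space M. X \<omega> \<in> B} =
        (\<integral>\<^sup>+t\<in>B \<inter> {0..<1}. ennreal (f t) \<partial>lborel) +
        (1 - (\<integral>\<^sup>+t\<in>{0..1}. ennreal (f t) \<partial>lborel)) * indicator B 1)"

(* For one realisation of values w and arrival times a: the items that would be accepted if
   reached, and the value of the earliest of them. Simultaneous arrivals go to the smaller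
   index; arrival times before 1 have densities and are independent, so this does not matter
   almost surely. *)
definition acceptable :: "nat \<Rightarrow> (nat \<Rightarrow> real \<Rightarrow> real) \<Rightarrow> (nat \<Rightarrow> real) \<Rightarrow> (nat \<Rightarrow> real) \<Rightarrow> nat set" where
  "acceptable n \<tau> w a = {i \<in> {1..n}. a i < 1 \<and> w i > \<tau> i (a i)}"

definition ALG :: "nat \<Rightarrow> (nat \<Rightarrow> real \<Rightarrow> real) \<Rightarrow> (nat \<Rightarrow> real) \<Rightarrow> (nat \<Rightarrow> real) \<Rightarrow> real" where
  "ALG n \<tau> w a =
     (if acceptable n \<tau> w a = {} then 0
      else w (LEAST i. i \<in> acceptable n \<tau> w a \<and> (\<forall>j\<in>acceptable n \<tau> w a. a i \<le> a j)))"

end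

theory Submission
  imports Defs
begin

(* Let Y_i be the largest of the values other than v_i. Since q_i(t) = P[Y_i > tau_i(t)], the law of
   Y_i is the image under tau_i of the measure q_i'(t) dt, so the integral of p_i q_i' is
   P[v_i > Y_i]. These events are disjoint, hence g >= 1 - Gamma > 0.
   By the choice of f_i, item i is not acceptable before time t with probability
   E_i(t) = exp (- Gamma * integral of q_i' p_i / g), and the product of the E_i is g because
   g' / g = - Gamma * sum of q_i' p_i / g. So the density of the event that item i arrives at time t
   and no other item was acceptable earlier is f_i * g / E_i = Gamma * q_i', and item i is accepted
   with a value above x with probability Gamma * P[v_i > max x Y_i]. Summing over i gives the
   claim, as ties have probability 0. *)

text \<open>Where \<open>fbar\<close> and \<open>gbar\<close> come from: let E_i(t) be the
  probability that item i has not been acceptable up to time t. To be accepted with density Gamma *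
  q_i', item i needs f_i * (product of E_j over j different from i) = Gamma * q_i'. As E_i' = - f_i
  * p_i, multiplying by p_i and summing over i gives (product of all E_j)' = - Gamma * (sum of p_i *
  q_i'), so the product must be g, which no longer mentions f. Dividing by g leaves (ln E_i)' = -
  Gamma * q_i' * p_i / g; solving this and putting f_i = Gamma * q_i' * E_i / g gives the formula of
  the algorithm. The obstacle is regularity. The function q_i is only known to be the integral of
  its derivative, which is meaningful almost everywhere and has no given sign, and the thresholds
  need not be differentiable. The differential equations above are therefore never differentiated.
  They become identities between integrals, and the chain rule is replaced by a pushforward: a
  continuous monotone map is determined as a change of variables by the tails of the image
  measure.\<close>

subsection \<open>Primitives of integrable functions\<close>

text \<open>Dominated convergence: the indicators converge except possibly at the endpoint
  \<open>a\<close>, a null set. For \<open>t < 0\<close> the interval is empty and the primitive is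
  0, so continuity, and later Borel measurability, holds on the whole line.\<close>

lemma continuous_on_lborel_primitive:
  fixes h :: "real \<Rightarrow> real"
  assumes "integrable lborel h"
  shows "continuous_on UNIV (\<lambda>t. LBINT s:{0..t}. h s)"
  unfolding continuous_on_sequentially
proof safe
  fix x :: "nat \<Rightarrow> real" and a assume x: "x \<longlonglongrightarrow> a"
  have [measurable]: "h \<in> borel_measurable borel"
    using assms by auto
  show "((\<lambda>t. LBINT s:{0..t}. h s) \<circ> x) \<longlonglongrightarrow> (LBINT s:{0..a}. h s)"
    unfolding set_lebesgue_integral_def o_def
  proof (rule integral_dominated_convergence[where w="\<lambda>s. \<bar>h s\<bar>"])
    show "AE s in lborel. (\<lambda>k. indicat_real {0..x k} s *\<^sub>R h s) \<longlonglongrightarrow> indicat_real {0..a} s *\<^sub>R h s"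
      using AE_lborel_singleton[of a]
    proof eventually_elim
      fix s assume "s \<noteq> a"
      then have "s < a \<or> a < s" by auto
      then have "\<forall>\<^sub>F k in sequentially. indicat_real {0..x k} s = indicat_real {0..a} s"
        using order_tendstoD[OF x, of s] by (auto elim!: eventually_mono simp: indicator_def)
      then show "(\<lambda>k. indicat_real {0..x k} s *\<^sub>R h s) \<longlonglongrightarrow> indicat_real {0..a} s *\<^sub>R h s"
        by (intro tendsto_eventually) (auto elim!: eventually_mono)
    qed
  qed (use assms in \<open>auto simp: indicator_def\<close>)
qed

text \<open>A monotone primitive \<open>H\<close> generates a Stieltjes measure, and
  \<open>h\<close> integrates over every Borel set to the measure of that set. On
  \<open>{s. h s < 0}\<close> this value is both at most 0 and at least 0, so the set is null. No
  differentiability of \<open>H\<close> enters.\<close>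

lemma AE_nonneg_if_mono_primitive:
  fixes h :: "real \<Rightarrow> real"
  assumes int: "integrable lborel h"
    and supp: "\<And>s. s \<notin> {0..c} \<Longrightarrow> h s = 0"
    and mono: "mono (\<lambda>t. LBINT s:{0..t}. h s)"
  shows "AE s in lborel. 0 \<le> h s"
proof -
  have [measurable]: "h \<in> borel_measurable borel"
    using int by auto
  define H where "H = (\<lambda>t. LBINT s:{0..t}. h s)"
  have H_Iic: "(LBINT s:{..t}. h s) = H t" for t
    unfolding H_def set_lebesgue_integral_def
    by (rule Bochner_Integration.integral_cong) (use supp in \<open>auto simp: indicator_def\<close>)
  have H_const: "H t = (LBINT s. h s)" if "c \<le> t" for t
    unfolding H_def set_lebesgue_integral_def
    by (rule Bochner_Integration.integral_cong) (use supp that in \<open>force simp: indicator_def\<close>)+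
  have H_neg: "H t = 0" if "t < 0" for t
    using that by (simp add: H_def set_lebesgue_integral_def)
  have bot: "(H \<longlongrightarrow> 0) at_bot"
    by (rule tendsto_eventually) (use H_neg in \<open>auto simp: eventually_at_bot_dense\<close>)
  have top: "(H \<longlongrightarrow> (LBINT s. h s)) at_top"
    by (rule tendsto_eventually) (use H_const in \<open>auto simp: eventually_at_top_linorder\<close>)
  have mono': "H x \<le> H y" if "x \<le> y" for x y
    using mono that by (auto simp: H_def mono_def)
  have rc: "continuous (at_right a) H" for a
    using continuous_on_lborel_primitive[OF int]
    unfolding H_def[symmetric] continuous_on_eq_continuous_at[OF open_UNIV]
    by (simp add: continuous_at_imp_continuous_at_within)
  \<comment> \<open>The point \<open>min c (-1)\<close> is negative and at most \<open>c\<close>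
    whatever the sign of \<open>c\<close>, so monotonicity compares the value 0 with the total
    integral.\<close>
  have tot: "0 \<le> (LBINT s. h s)"
    using mono'[of "min c (-1)" c] H_neg[of "min c (-1)"] H_const[of c] by simp
  let ?N = "interval_measure H"
  interpret N: finite_borel_measure ?N
    by (rule finite_borel_measure_interval_measure[OF _ rc bot top tot]) (rule mono')
  have tot_N: "measure ?N UNIV = (LBINT s. h s)"
    using interval_measure_UNIV[OF _ rc bot top tot] mono' tot by (simp add: measure_def)
  \<comment> \<open>Since \<open>h\<close> may still change sign, its integrals are not yet known to
    form a measure and uniqueness of measures does not apply. The induction over the half-lines
    checks complements and disjoint unions directly.\<close>
  have N_eq: "(LBINT s:B. h s) = measure ?N B" if "B \<in> sets borel" for B
  proof -
    have "Int_stable (range (\<lambda>a::real. {..a}))" "range (\<lambda>a::real. {..a}) \<subseteq> Pow UNIV"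
      by (auto simp: Int_stable_def)
    moreover have "B \<in> sigma_sets UNIV (range (\<lambda>a::real. {..a}))"
      using that by (simp add: borel_eq_atMost)
    ultimately show ?thesis
    proof (induction rule: sigma_sets_induct_disjoint)
      case (basic A)
      then show ?case
        using measure_interval_measure_Iic[OF _ rc bot] mono' H_Iic by auto
    next
      case empty
      then show ?case by (simp add: set_lebesgue_integral_def)
    next
      case (compl A)
      then have A: "A \<in> sets borel" by (simp add: borel_eq_atMost)
      have *: "indicat_real A s *\<^sub>R h s + indicat_real (- A) s *\<^sub>R h s = h s" for s
        by (simp add: indicator_def)
      have "(LBINT s. h s) = (LBINT s:A. h s) + (LBINT s:UNIV - A. h s)"
        unfolding set_lebesgue_integral_def
        by (subst Bochner_Integration.integral_add[symmetric])
          (simp_all only: * integrable_mult_indicator[OF _ int] A sets_lborel borel_comp Compl_eq_Diff_UNIV[symmetric])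
      moreover have "measure ?N (UNIV - A) = measure ?N UNIV - measure ?N A"
        using A N.finite_measure_compl[of A] by simp
      ultimately show ?case
        using compl tot_N by simp
    next
      case (union A)
      then have A: "A i \<in> sets borel" for i by (auto simp: borel_eq_atMost)
      have "(LBINT s:(\<Union>i. A i). h s) = (\<Sum>i. LBINT s:A i. h s)"
      proof (rule lebesgue_integral_countable_add)
        show "set_integrable lborel (\<Union>i. A i) h"
          unfolding set_integrable_def using A by (intro integrable_mult_indicator[OF _ int]) auto
      qed (use A union(1) in \<open>auto simp: disjoint_family_on_def\<close>)
      also have "\<dots> = (\<Sum>i. measure ?N (A i))"
        using union by simp
      also have "\<dots> = measure ?N (\<Union>i. A i)"
        by (rule sums_unique[symmetric], rule N.finite_measure_UNION) (use A union(1) in auto)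
      finally show ?case .
    qed
  qed
  let ?B = "{s. h s < 0}"
  have B: "?B \<in> sets borel" by measurable
  have int_B: "integrable lborel (\<lambda>s. indicat_real ?B s *\<^sub>R h s)"
    by (rule integrable_mult_indicator[OF _ int]) (use B in simp)
  let ?n = "\<lambda>s. - (indicat_real ?B s *\<^sub>R h s)"
  have n: "0 \<le> ?n s" for s
    by (simp add: indicator_def)
  have "(LBINT s. ?n s) = - measure ?N ?B"
    using N_eq[OF B] by (simp only: set_lebesgue_integral_def Bochner_Integration.integral_minus)
  moreover have "0 \<le> (LBINT s. ?n s)"
    using n by (intro integral_nonneg_AE AE_I2)
  ultimately have "(LBINT s. ?n s) = 0"
    using measure_nonneg[of ?N ?B] by linarith
  then have "AE s in lborel. ?n s = 0"
    using int_B n by (subst (asm) integral_nonneg_eq_0_iff_AE) (auto simp del: real_scaleR_def)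
  then show ?thesis
    by eventually_elim (auto simp: indicator_def split: if_splits)
qed

(* Applied with N the law of Y_i, and, for the substitution rule below, with N a uniform measure. *)
lemma distr_density_eq_of_antimono:
  fixes h \<sigma> :: "real \<Rightarrow> real" and N :: "real measure"
  assumes N: "finite_measure N" "sets N = sets borel"
    and c: "0 \<le> c"
    and h: "integrable lborel h" "\<And>s. 0 \<le> h s"
    and \<sigma>: "\<sigma> \<in> borel_measurable borel" "antimono_on {0..c} \<sigma>" "continuous_on {0..c} \<sigma>"
    and tail: "\<And>t. t \<in> {0..c} \<Longrightarrow> measure N {\<sigma> t<..} = (LBINT s:{0..t}. h s)"
    and bot: "measure N {\<sigma> c<..} = measure N UNIV"
  shows "distr (density lborel (\<lambda>s. ennreal (h s * indicator {0..c} s))) borel \<sigma> = N"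
proof (rule measure_eqI_lessThan)
  interpret N: finite_measure N by fact
  note [measurable] = \<sigma>(1)
  have [measurable]: "h \<in> borel_measurable borel"
    using h(1) by auto
  let ?D = "density lborel (\<lambda>s. ennreal (h s * indicator {0..c} s))"
  have D: "emeasure (distr ?D borel \<sigma>) {a<..} = (LBINT s:{s\<in>{0..c}. a < \<sigma> s}. h s)" for a
  proof -
    have "emeasure (distr ?D borel \<sigma>) {a<..} = (\<integral>\<^sup>+s. ennreal (h s * indicator {0..c} s) * indicator (\<sigma> -` {a<..}) s \<partial>lborel)"
      by (subst emeasure_distr, simp, simp, subst emeasure_density) (auto intro!: measurable_sets_borel[OF \<sigma>(1)])
    also have "\<dots> = (\<integral>\<^sup>+s. ennreal (indicator {s\<in>{0..c}. a < \<sigma> s} s * h s) \<partial>lborel)"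
      by (rule nn_integral_cong) (auto simp: indicator_def)
    also have "\<dots> = (LBINT s:{s\<in>{0..c}. a < \<sigma> s}. h s)"
      unfolding set_lebesgue_integral_def real_scaleR_def
      by (subst nn_integral_eq_integral)
        (auto simp: h(2) intro!: integrable_mult_indicator[OF _ h(1), unfolded real_scaleR_def])
    finally show ?thesis .
  qed
  show "emeasure (distr ?D borel \<sigma>) {a<..} < \<infinity>" for a
    by (simp add: D)
  fix a
  have int_zero: "(LBINT s:{t}. h s) = 0" for t
    unfolding set_lebesgue_integral_def
    by (rule integral_eq_zero_AE, rule AE_mp[OF AE_lborel_singleton[of t]]) auto
  have "(LBINT s:{s\<in>{0..c}. a < \<sigma> s}. h s) = measure N {a<..}"
  proof -
    consider "a < \<sigma> c" | "\<sigma> 0 \<le> a" | "\<sigma> c \<le> a" "a < \<sigma> 0" by linarith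
    then show ?thesis
    proof cases
      case 1
      then have "{s\<in>{0..c}. a < \<sigma> s} = {0..c}"
        using \<sigma>(2) c by (force simp: monotone_on_def)
      \<comment> \<open>By \<open>bot\<close>, \<open>N\<close> has no mass at or below
        \<open>\<sigma> c\<close>, so lowering the level further gains nothing.\<close>
      moreover have "measure N {a<..} = measure N UNIV"
        using bot 1 N.finite_measure_mono[of "{\<sigma> c<..}" "{a<..}"] N.finite_measure_mono[of "{a<..}" UNIV] N(2)
        by auto
      ultimately show ?thesis
        using tail[of c] c bot by auto
    next
      case 2
      then have empty: "{s\<in>{0..c}. a < \<sigma> s} = {}"
        using \<sigma>(2) c by (force simp: monotone_on_def)
      have "(LBINT s:{s\<in>{0..c}. a < \<sigma> s}. h s) = 0"
        unfolding empty by (simp add: set_lebesgue_integral_def)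
      moreover have "measure N {a<..} \<le> measure N {\<sigma> 0<..}"
        using 2 N(2) by (intro N.finite_measure_mono) auto
      moreover have "measure N {\<sigma> 0<..} = 0"
        using tail[of 0] c int_zero[of 0] by simp
      ultimately show ?thesis
        using measure_nonneg[of N "{a<..}"] by simp
    next
      case 3
      \<comment> \<open>A weakly decreasing \<open>\<sigma>\<close> may stay at the level
        \<open>a\<close> on a whole interval. The least point \<open>s0\<close> of the level set is
        the place where \<open>\<sigma>\<close> stops exceeding \<open>a\<close>, and the tail
        hypothesis is applied there.\<close>
      let ?K = "{s\<in>{0..c}. \<sigma> s = a}"
      have "\<exists>s\<ge>0. s \<le> c \<and> \<sigma> s = a"
        using 3 c \<sigma>(3) by (intro IVT2') auto
      moreover have "closed ?K"
        using continuous_closed_preimage[OF \<sigma>(3), of "{a}"] by (auto simp: vimage_def Int_def)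
      then have "compact ?K"
        by (subst compact_eq_bounded_closed) (auto intro: bounded_subset[OF bounded_closed_interval])
      ultimately obtain s0 where s0: "s0 \<in> {0..c}" "\<sigma> s0 = a" and least: "\<And>s. s \<in> ?K \<Longrightarrow> s0 \<le> s"
        using compact_attains_inf[of ?K] by auto
      have "{s\<in>{0..c}. a < \<sigma> s} = {0..<s0}"
      proof (intro set_eqI iffI)
        fix s assume "s \<in> {s\<in>{0..c}. a < \<sigma> s}"
        then show "s \<in> {0..<s0}"
          using s0 \<sigma>(2) unfolding monotone_on_def by (metis (mono_tags, lifting) atLeastAtMost_iff atLeastLessThan_iff mem_Collect_eq not_le)
      next
        fix s assume s: "s \<in> {0..<s0}"
        then have "\<sigma> s0 \<le> \<sigma> s" "\<sigma> s \<noteq> a"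
          using s0 \<sigma>(2) least[of s] unfolding monotone_on_def by auto
        then show "s \<in> {s\<in>{0..c}. a < \<sigma> s}"
          using s s0 by auto
      qed
      moreover have "(LBINT s:{0..<s0}. h s) = (LBINT s:{0..s0}. h s)"
        unfolding set_lebesgue_integral_def
      proof (rule integral_cong_AE)
        show "AE s in lborel. indicat_real {0..<s0} s *\<^sub>R h s = indicat_real {0..s0} s *\<^sub>R h s"
          using AE_lborel_singleton[of s0] by eventually_elim (auto simp: indicator_def)
      qed simp_all
      ultimately show ?thesis
        using tail[of s0] s0 by simp
    qed
  qed
  then show "emeasure (distr ?D borel \<sigma>) {a<..} = emeasure N {a<..}"
    by (simp add: D N.emeasure_eq_measure)
qed (simp_all add: N)

text \<open>Substitution \<open>u = H s\<close> without differentiating \<open>H\<close>: the map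
  \<open>H\<close> sends the measure with density \<open>h\<close> on \<open>{0..t}\<close> to
  Lebesgue measure on \<open>{0..H t}\<close>, where the fundamental theorem applies to the smooth
  outer function. With a logarithm and an exponential as \<open>\<phi>\<close> it solves the two
  differential equations of the proof.\<close>

lemma lborel_integral_comp_primitive:
  fixes h \<phi> \<phi>' :: "real \<Rightarrow> real"
  assumes h: "integrable lborel h" "\<And>s. 0 \<le> h s" and "0 \<le> t"
    and H_def: "\<And>t. H t = (LBINT s:{0..t}. h s)"
    and \<phi>: "\<And>u. u \<in> {0..H t} \<Longrightarrow> (\<phi> has_real_derivative \<phi>' u) (at u within {0..H t})"
    and \<phi>': "continuous_on {0..H t} \<phi>'"
  shows "(LBINT s:{0..t}. h s * \<phi>' (H s)) = \<phi> (H t) - \<phi> 0"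
proof -
  have [measurable]: "h \<in> borel_measurable borel"
    using h(1) by auto
  have cont: "continuous_on UNIV H"
    using continuous_on_lborel_primitive[OF h(1)] by (simp add: H_def[abs_def])
  have [measurable]: "H \<in> borel_measurable borel"
    using cont by (rule borel_measurable_continuous_onI)
  have int: "integrable lborel (\<lambda>s. indicator A s *\<^sub>R h s)" if "A \<in> sets borel" for A
    using that by (intro integrable_mult_indicator[OF _ h(1)]) simp
  have mono: "H a \<le> H b" if "a \<le> b" for a b
    unfolding H_def set_lebesgue_integral_def
    by (rule integral_mono[OF int int]) (use that h(2) in \<open>auto simp: indicator_def\<close>)
  have H0: "H 0 = 0"
    unfolding H_def set_lebesgue_integral_def
    by (rule integral_eq_zero_AE, rule AE_mp[OF AE_lborel_singleton[of 0]]) auto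
  have Ht: "0 \<le> H t"
    using mono[of 0 t] \<open>0 \<le> t\<close> H0 by simp
  \<comment> \<open>The pushforward lemma is about decreasing maps, hence the reflection:
    \<open>- H\<close> has the uniform measure on \<open>{- H t..0}\<close> as image.\<close>
  let ?N = "density lborel (\<lambda>u. ennreal (indicator {- H t..0} u))"
  have N: "emeasure ?N A = emeasure lborel ({- H t..0} \<inter> A)" if "A \<in> sets borel" for A
    using that
    by (subst emeasure_density) (auto simp: ennreal_indicator simp flip: indicator_inter_arith)
  have Nm: "measure ?N A = measure lborel ({- H t..0} \<inter> A)" if "A \<in> sets borel" for A
    using N[OF that] by (simp add: measure_def)
  have distr: "distr (density lborel (\<lambda>s. ennreal (h s * indicator {0..t} s))) borel (\<lambda>s. - H s) = ?N"
  proof (rule distr_density_eq_of_antimono)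
    show "finite_measure ?N"
      using N[of UNIV] Ht by (intro finite_measureI) auto
    show "measure ?N {- H s<..} = (LBINT r:{0..s}. h r)" if "s \<in> {0..t}" for s
    proof -
      have "H s \<le> H t" "0 \<le> H s"
        using mono[of s t] mono[of 0 s] that H0 by auto
      then have "{- H t..0} \<inter> {- H s<..} = {- H s<..0}"
        by auto
      then show ?thesis
        using \<open>0 \<le> H s\<close> by (subst Nm) (auto simp: H_def)
    qed
    have "{- H t..0} \<inter> {- H t<..} = {- H t<..0}"
      by auto
    then show "measure ?N {- H t<..} = measure ?N UNIV"
      using Ht by (subst (1 2) Nm) auto
    show "antimono_on {0..t} (\<lambda>s. - H s)"
      using mono by (auto simp: monotone_on_def)
    show "continuous_on {0..t} (\<lambda>s. - H s)"
      by (intro continuous_on_minus continuous_on_subset[OF cont]) simp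
  qed (use h \<open>0 \<le> t\<close> in auto)
  \<comment> \<open>Continuity of \<open>\<phi>'\<close> is known on \<open>{0..H t}\<close> only;
    cutting off outside makes the integrand Borel on the whole line.\<close>
  define \<psi> where "\<psi> = (\<lambda>u. indicator {- H t..0} u *\<^sub>R \<phi>' (- u))"
  have cont\<psi>: "continuous_on {- H t..0} (\<lambda>u. \<phi>' (- u))"
    by (rule continuous_on_compose2[OF \<phi>']) (auto intro!: continuous_intros)
  have [measurable]: "\<psi> \<in> borel_measurable borel"
    unfolding \<psi>_def by (rule borel_measurable_continuous_on_indicator[OF _ cont\<psi>]) simp
  have "(LBINT s:{0..t}. h s * \<phi>' (H s)) = (LBINT s. (h s * indicator {0..t} s) *\<^sub>R \<psi> (- H s))"
    unfolding set_lebesgue_integral_def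
    by (rule Bochner_Integration.integral_cong)
      (use mono[of 0] mono[of _ t] H0 in \<open>auto simp: \<psi>_def indicator_def\<close>)
  also have "\<dots> = integral\<^sup>L (distr (density lborel (\<lambda>s. ennreal (h s * indicator {0..t} s))) borel (\<lambda>s. - H s)) \<psi>"
    by (subst integral_distr) (auto simp: integral_density h(2))
  also have "\<dots> = (LBINT u. indicator {- H t..0} u *\<^sub>R \<psi> u)"
    unfolding distr by (subst integral_density) auto
  also have "\<dots> = (LBINT u. indicator {- H t..0} u *\<^sub>R \<phi>' (- u))"
    by (rule Bochner_Integration.integral_cong) (auto simp: \<psi>_def indicator_def)
  also have "\<dots> = - \<phi> (- 0) - (- \<phi> (- (- H t)))"
  proof (rule integral_FTC_Icc)
    fix u assume u: "- H t \<le> u" "u \<le> 0"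
    have "((\<lambda>u. \<phi> (- u)) has_real_derivative \<phi>' (- u) * (- 1)) (at u within {- H t..0})"
    proof -
      have "(uminus has_real_derivative - 1) (at u within {- H t..0})"
        by (auto intro!: derivative_eq_intros)
      moreover have "(\<phi> has_real_derivative \<phi>' (- u)) (at (- u) within uminus ` {- H t..0})"
        using \<phi>[of "- u"] u by simp
      ultimately show ?thesis
        using DERIV_image_chain[of \<phi> "\<phi>' (- u)" uminus u "{- H t..0}" "-1"] by (simp add: o_def)
    qed
    from DERIV_minus[OF this]
    show "((\<lambda>u. - \<phi> (- u)) has_vector_derivative \<phi>' (- u)) (at u within {- H t..0})"
      by (simp add: has_real_derivative_iff_has_vector_derivative)
  qed (use Ht cont\<psi> in auto)
  finally show ?thesis by simp
qed

lemma mult_sum_set_lborel_integral: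
  fixes f :: "'i \<Rightarrow> real \<Rightarrow> real"
  assumes "\<And>i. i \<in> I \<Longrightarrow> integrable lborel (f i)" "A \<in> sets borel"
  shows "c * (\<Sum>i\<in>I. LBINT s:A. f i s) = (LBINT s:A. c * (\<Sum>i\<in>I. f i s))"
proof -
  have "(LBINT s:A. c * (\<Sum>i\<in>I. f i s)) = (LBINT s. c * (\<Sum>i\<in>I. indicator A s *\<^sub>R f i s))"
    by (simp add: set_lebesgue_integral_def sum_distrib_left mult_ac)
  also have "\<dots> = c * (\<Sum>i\<in>I. LBINT s. indicator A s *\<^sub>R f i s)"
    using integrable_mult_indicator[OF _ assms(1)] assms(2)
    by (simp only: integral_mult_right_zero sets_lborel Bochner_Integration.integral_sum)
  finally show ?thesis
    by (simp only: set_lebesgue_integral_def)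
qed

section \<open>Integral identities between \<open>g\<close>, \<open>E\<close> and the densities,
  free of probability\<close>

locale arrival_densities =
  fixes I :: "'i set" and h p :: "'i \<Rightarrow> real \<Rightarrow> real" and \<Gamma> :: real
  assumes finite_I: "finite I" and \<Gamma>: "0 < \<Gamma>" "\<Gamma> < 1"
    and h: "\<And>i. i \<in> I \<Longrightarrow> integrable lborel (h i)" "\<And>i s. 0 \<le> h i s"
    and p: "\<And>i. i \<in> I \<Longrightarrow> p i \<in> borel_measurable borel" "\<And>i s. 0 \<le> p i s" "\<And>i s. p i s \<le> 1"
    and total: "(\<Sum>i\<in>I. LBINT s. p i s * h i s) \<le> 1"
begin

definition g :: "real \<Rightarrow> real" where
  "g t = 1 - \<Gamma> * (\<Sum>i\<in>I. LBINT s:{0..t}. p i s * h i s)"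

(* E i t turns out to be the probability that item i has not been acceptable up to time t. *)
definition E :: "'i \<Rightarrow> real \<Rightarrow> real" where
  "E i t = exp (- \<Gamma> * (LBINT s:{0..t}. h i s * p i s / g s))"

lemma h_measurable [measurable]: "i \<in> I \<Longrightarrow> h i \<in> borel_measurable borel"
  using h(1)[of i] by auto

lemma p_measurable [measurable]: "i \<in> I \<Longrightarrow> p i \<in> borel_measurable borel"
  by (rule p(1))

lemma integrable_ph: "i \<in> I \<Longrightarrow> integrable lborel (\<lambda>s. p i s * h i s)"
  by (rule Bochner_Integration.integrable_bound[OF h(1)[of i]])
    (use h p in \<open>auto intro!: AE_I2 simp: abs_mult mult_left_le_one_le\<close>)

lemma integrable_ph_set: "i \<in> I \<Longrightarrow> A \<in> sets borel \<Longrightarrow> integrable lborel (\<lambda>s. indicator A s *\<^sub>R (p i s * h i s))"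
  by (rule integrable_mult_indicator[OF _ integrable_ph]) auto

lemma g_ge: "1 - \<Gamma> \<le> g t"
proof -
  have "(\<Sum>i\<in>I. LBINT s:{0..t}. p i s * h i s) \<le> (\<Sum>i\<in>I. LBINT s. p i s * h i s)"
    unfolding set_lebesgue_integral_def
    by (intro sum_mono integral_mono[OF integrable_ph_set integrable_ph])
      (use h p in \<open>auto simp: indicator_def\<close>)
  with total have "(\<Sum>i\<in>I. LBINT s:{0..t}. p i s * h i s) \<le> 1"
    by linarith
  then show ?thesis
    unfolding g_def using \<Gamma> by simp
qed

lemma g_pos: "0 < g t"
  using g_ge[of t] \<Gamma> by linarith

lemma g_measurable [measurable]: "g \<in> borel_measurable borel"
  unfolding g_def
  by (intro borel_measurable_continuous_onI continuous_intros continuous_on_lborel_primitive integrable_ph)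

text \<open>The domination rests on \<open>g\<close> being bounded away from 0 by
  \<open>1 - \<Gamma>\<close>; mere positivity would give no integrable bound.\<close>

lemma integrable_phg: "i \<in> I \<Longrightarrow> integrable lborel (\<lambda>s. h i s * p i s / g s)"
proof (rule Bochner_Integration.integrable_bound)
  assume i: "i \<in> I"
  show "integrable lborel (\<lambda>s. h i s / (1 - \<Gamma>))"
    using h(1)[OF i] by simp
  have "h i s * p i s / g s \<le> h i s / (1 - \<Gamma>)" for s
    by (intro frac_le g_ge) (use h p \<Gamma> in \<open>auto intro: mult_left_le\<close>)
  then show "AE s in lborel. norm (h i s * p i s / g s) \<le> norm (h i s / (1 - \<Gamma>))"
    using h(2) p(2) g_pos \<Gamma> by (simp add: less_imp_le)
qed simp

lemma E_measurable [measurable]: "i \<in> I \<Longrightarrow> E i \<in> borel_measurable borel"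
  unfolding E_def
  by (intro borel_measurable_continuous_onI continuous_intros continuous_on_lborel_primitive integrable_phg)

lemma E_pos: "0 < E i t"
  by (simp add: E_def)

lemma prod_E:
  assumes "0 \<le> t"
  shows "(\<Prod>i\<in>I. E i t) = g t"
proof -
  let ?k = "\<lambda>s. \<Gamma> * (\<Sum>i\<in>I. p i s * h i s)"
  have K: "1 - g t = (LBINT s:{0..t}. ?k s)" for t
    unfolding g_def using integrable_ph by (subst mult_sum_set_lborel_integral[symmetric]) auto
  \<comment> \<open>Writing \<open>g s\<close> as \<open>1 - (1 - g s)\<close> exhibits the
    integrand as \<open>?k s * \<phi>' (H s)\<close> with the primitive \<open>H = 1 - g\<close> of
    \<open>?k\<close> and \<open>\<phi> u = - ln (1 - u)\<close>.\<close>
  have "\<Gamma> * (\<Sum>i\<in>I. LBINT s:{0..t}. h i s * p i s / g s) = (LBINT s:{0..t}. ?k s * (1 / (1 - (1 - g s))))"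
    using integrable_phg
    by (subst mult_sum_set_lborel_integral)
      (auto simp: sum_divide_distrib sum_distrib_left mult_ac intro!: set_lebesgue_integral_cong)
  also have "\<dots> = - ln (1 - (1 - g t)) - (- ln (1 - 0))"
  proof (rule lborel_integral_comp_primitive[where \<phi>="\<lambda>u. - ln (1 - u)", OF _ _ assms K])
    show "integrable lborel ?k"
      using integrable_ph by auto
    show "0 \<le> ?k s" for s
      using h p \<Gamma> by (auto intro!: mult_nonneg_nonneg sum_nonneg)
  qed (use g_pos[of t] in \<open>auto intro!: derivative_eq_intros continuous_intros simp: field_simps\<close>)
  finally have "- \<Gamma> * (\<Sum>i\<in>I. LBINT s:{0..t}. h i s * p i s / g s) = ln (g t)"
    by simp
  then show ?thesis
    unfolding E_def using g_pos[of t]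
    by (simp add: exp_sum[OF finite_I, symmetric] sum_distrib_left sum_negf)
qed

text \<open>The integrand is formally the derivative of \<open>- E i\<close>; the substitution is
  made with \<open>\<phi> u = - exp (- \<Gamma> * u)\<close>. The left-hand side will be the
  probability that item i arrives by time t and beats its threshold.\<close>

lemma integral_density_E:
  assumes i: "i \<in> I" and "0 \<le> t"
  shows "(LBINT s:{0..t}. \<Gamma> * (h i s / g s) * E i s * p i s) = 1 - E i t"
proof -
  let ?H = "\<lambda>t. LBINT s:{0..t}. h i s * p i s / g s"
  have "(LBINT s:{0..t}. h i s * p i s / g s * (\<Gamma> * exp (- \<Gamma> * ?H s))) = - exp (- \<Gamma> * ?H t) - - exp (- \<Gamma> * 0)"
  proof (rule lborel_integral_comp_primitive[where \<phi>="\<lambda>u. - exp (- \<Gamma> * u)"])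
    show "0 \<le> h i s * p i s / g s" for s
      using h(2) p(2) g_pos[of s] by (simp add: less_imp_le)
  qed (use assms integrable_phg in \<open>auto intro!: derivative_eq_intros continuous_intros\<close>)
  then show ?thesis
    by (simp add: E_def field_simps)
qed

end

subsection \<open>The arrival process\<close>

lemma (in prob_space) nn_integral_indep_var:
  assumes ind: "indep_var N U L W" and [measurable]: "k \<in> borel_measurable (N \<Otimes>\<^sub>M L)"
  shows "(\<integral>\<^sup>+\<omega>. k (U \<omega>, W \<omega>) \<partial>M) = (\<integral>\<^sup>+u. (\<integral>\<^sup>+\<omega>. k (u, W \<omega>) \<partial>M) \<partial>distr M N U)"
proof -
  note [measurable] = indep_var_rv1[OF ind] indep_var_rv2[OF ind]
  interpret W: prob_space "distr M L W"
    by (rule prob_space_distr) measurable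
  have "(\<integral>\<^sup>+\<omega>. k (U \<omega>, W \<omega>) \<partial>M) = integral\<^sup>N (distr M N U \<Otimes>\<^sub>M distr M L W) k"
    using ind unfolding indep_var_distribution_eq by (simp add: nn_integral_distr)
  also have "\<dots> = (\<integral>\<^sup>+u. (\<integral>\<^sup>+w. k (u, w) \<partial>distr M L W) \<partial>distr M N U)"
    by (rule W.nn_integral_fst[symmetric]) simp
  also have "\<dots> = (\<integral>\<^sup>+u. (\<integral>\<^sup>+\<omega>. k (u, W \<omega>) \<partial>M) \<partial>distr M N U)"
    by (rule nn_integral_cong) (simp add: nn_integral_distr)
  finally show ?thesis .
qed

text \<open>Fubini for the joint law. The inner event is kept on \<open>M\<close> instead of being
  moved to the law of \<open>W\<close>, so that independence on \<open>M\<close> can be used again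
  once \<open>u\<close> is frozen.\<close>

lemma (in prob_space) emeasure_indep_var:
  assumes ind: "indep_var N U L W" and [measurable]: "Measurable.pred (N \<Otimes>\<^sub>M L) (\<lambda>z. R (fst z) (snd z))"
  shows "emeasure M {\<omega>\<in>space M. R (U \<omega>) (W \<omega>)} =
    (\<integral>\<^sup>+u. emeasure M {\<omega>\<in>space M. R u (W \<omega>)} \<partial>distr M N U)"
proof -
  note [measurable] = indep_var_rv1[OF ind] indep_var_rv2[OF ind]
  have R: "Measurable.pred M (\<lambda>\<omega>. R (U \<omega>) (W \<omega>))"
    using measurable_compose[OF measurable_Pair[OF indep_var_rv1[OF ind] indep_var_rv2[OF ind]] assms(2)]
    by simp
  have Ru: "Measurable.pred M (\<lambda>\<omega>. R u (W \<omega>))" if "u \<in> space N" for u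
    using measurable_compose[OF measurable_Pair1'[OF that] assms(2), THEN measurable_compose[OF indep_var_rv2[OF ind]]]
    by simp
  have "emeasure M {\<omega>\<in>space M. R (U \<omega>) (W \<omega>)} =
    (\<integral>\<^sup>+\<omega>. indicator {\<omega>\<in>space M. R (U \<omega>) (W \<omega>)} \<omega> \<partial>M)"
    using R by simp
  also have "\<dots> = (\<integral>\<^sup>+\<omega>. indicator {z. R (fst z) (snd z)} (U \<omega>, W \<omega>) \<partial>M)"
    by (rule nn_integral_cong) (simp add: indicator_def)
  also have "\<dots> = (\<integral>\<^sup>+u. (\<integral>\<^sup>+\<omega>. indicator {z. R (fst z) (snd z)} (u, W \<omega>) \<partial>M) \<partial>distr M N U)"
    by (rule nn_integral_indep_var[OF ind]) simp
  also have "\<dots> = (\<integral>\<^sup>+u. emeasure M {\<omega>\<in>space M. R u (W \<omega>)} \<partial>distr M N U)"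
  proof (rule nn_integral_cong)
    fix u assume "u \<in> space (distr M N U)"
    then have "emeasure M {\<omega>\<in>space M. R u (W \<omega>)} = (\<integral>\<^sup>+\<omega>. indicator {\<omega>\<in>space M. R u (W \<omega>)} \<omega> \<partial>M)"
      using Ru[of u] by simp
    also have "\<dots> = (\<integral>\<^sup>+\<omega>. indicator {z. R (fst z) (snd z)} (u, W \<omega>) \<partial>M)"
      by (rule nn_integral_cong) (simp add: indicator_def)
    finally show "(\<integral>\<^sup>+\<omega>. indicator {z. R (fst z) (snd z)} (u, W \<omega>) \<partial>M) = emeasure M {\<omega>\<in>space M. R u (W \<omega>)}"
      by simp
  qed
  finally show ?thesis .
qed

section \<open>Values, thresholds and the law of the strongest competitor\<close>

locale order_selection = prob_space M for M :: "'a measure" +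
  fixes n :: nat and v T :: "nat \<Rightarrow> 'a \<Rightarrow> real" and \<tau> :: "nat \<Rightarrow> real \<Rightarrow> real" and \<Gamma> :: real
  assumes n: "n > 1"
    and density: "\<And>i. i \<in> {1..n} \<Longrightarrow> interval_density M (v i)"
    and Gamma: "0 < \<Gamma>" "\<Gamma> < 1"
    and antimono: "\<And>i. i \<in> {1..n} \<Longrightarrow> strict_antimono_on {0..1} (\<tau> i)"
    and cont: "\<And>i. i \<in> {1..n} \<Longrightarrow> continuous_on {0..1} (\<tau> i)"
    and surj: "\<And>i. i \<in> {1..n} \<Longrightarrow> surjective_threshold M n v \<tau> i"
    and deriv: "\<And>i. i \<in> {1..n} \<Longrightarrow> integral_of_deriv (qbar M n v \<tau> i)"
    and law: "\<And>i. i \<in> {1..n} \<Longrightarrow> has_arrival_law M (T i) (fbar M n v \<tau> \<Gamma> i)"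
    and indep: "indep_vars (\<lambda>_. borel) (case_sum v T) ({1..n} <+> {1..n})"
begin

definition Y :: "nat \<Rightarrow> 'a \<Rightarrow> real" where
  "Y i \<omega> = Max ((\<lambda>j. v j \<omega>) ` ({1..n} - {i}))"

(* Extending the thresholds constantly beyond [0,1] makes them continuous, hence measurable, on
   the whole line. *)
definition \<sigma> :: "nat \<Rightarrow> real \<Rightarrow> real" where
  "\<sigma> i t = \<tau> i (max 0 (min 1 t))"

text \<open>The version of \<open>pbar\<close> for the extended threshold: it is increasing on the
  whole line and hence Borel, and agrees with \<open>pbar\<close> on \<open>{0..1}\<close>.\<close>

definition p :: "nat \<Rightarrow> real \<Rightarrow> real" where
  "p i t = prob {\<omega>\<in>space M. \<sigma> i t < v i \<omega>}"

(* deriv may take arbitrary values on a null set; truncating at 0 gives a density of qbar that is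
   nonnegative everywhere. *)
definition h :: "nat \<Rightarrow> real \<Rightarrow> real" where
  "h i t = max 0 (indicator {0..1} t * deriv (qbar M n v \<tau> i) t)"

lemma v_measurable [measurable]: "i \<in> {1..n} \<Longrightarrow> v i \<in> borel_measurable M"
  using indep unfolding indep_vars_def by (auto dest!: bspec[of _ _ "Inl i"])

lemma T_measurable [measurable]: "i \<in> {1..n} \<Longrightarrow> T i \<in> borel_measurable M"
  using indep unfolding indep_vars_def by (auto dest!: bspec[of _ _ "Inr i"])

lemma T_range: "i \<in> {1..n} \<Longrightarrow> \<omega> \<in> space M \<Longrightarrow> T i \<omega> \<in> {0..1}"
  using law unfolding has_arrival_law_def by auto

lemma prob_v_eq:
  assumes "i \<in> {1..n}"
  shows "emeasure M {\<omega>\<in>space M. v i \<omega> = y} = 0"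
proof -
  obtain d where d: "distributed M lborel (v i) d"
    using density[OF assms] unfolding interval_density_def by auto
  have [measurable]: "d \<in> borel_measurable borel"
    using distributed_borel_measurable[OF d] by simp
  have "emeasure M (v i -` {y} \<inter> space M) = (\<integral>\<^sup>+x. d x * indicator {y} x \<partial>lborel)"
    by (rule distributed_emeasure[OF d]) simp
  also have "\<dots> = 0"
    by (rule nn_integral_0_iff_AE[THEN iffD2], simp, rule AE_mp[OF AE_lborel_singleton[of y]]) auto
  finally show ?thesis
    by (simp add: vimage_def Int_def conj_commute)
qed

lemma others_nonempty: "{1..n} - {i} \<noteq> {}"
proof -
  have "(if i = 1 then 2 else 1) \<in> {1..n} - {i}" using n by auto
  then show ?thesis by blast
qed

lemma Y_less_iff: "Y i \<omega> < a \<longleftrightarrow> (\<forall>j\<in>{1..n} - {i}. v j \<omega> < a)"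
  unfolding Y_def using others_nonempty[of i] by (subst Max_less_iff) auto

lemma Y_measurable [measurable]: "Y i \<in> borel_measurable M"
  unfolding Y_def[abs_def] by (rule borel_measurable_Max) auto

lemma \<sigma>_eq: "t \<in> {0..1} \<Longrightarrow> \<sigma> i t = \<tau> i t"
  by (simp add: \<sigma>_def)

lemma \<sigma>_antimono: "i \<in> {1..n} \<Longrightarrow> s \<le> t \<Longrightarrow> \<sigma> i t \<le> \<sigma> i s"
proof (cases "max 0 (min 1 s) = max 0 (min 1 t)")
  case False
  assume "i \<in> {1..n}" "s \<le> t"
  moreover from this False have "max 0 (min 1 s) < max 0 (min 1 t)"
    by linarith
  ultimately show ?thesis
    unfolding \<sigma>_def by (intro less_imp_le monotone_onD[OF antimono]) auto
qed (simp add: \<sigma>_def)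

lemma continuous_\<sigma>: "i \<in> {1..n} \<Longrightarrow> continuous_on UNIV (\<sigma> i)"
  unfolding \<sigma>_def by (rule continuous_on_compose2[OF cont]) (auto intro!: continuous_intros)

lemma \<sigma>_measurable [measurable]: "i \<in> {1..n} \<Longrightarrow> \<sigma> i \<in> borel_measurable borel"
  by (intro borel_measurable_continuous_onI continuous_\<sigma>)

lemma pbar_eq: "t \<in> {0..1} \<Longrightarrow> pbar M v \<tau> i t = p i t"
  by (simp add: pbar_def p_def \<sigma>_eq)

lemma qbar_eq: "t \<in> {0..1} \<Longrightarrow> qbar M n v \<tau> i t = prob {\<omega>\<in>space M. \<sigma> i t < Y i \<omega>}"
  by (simp add: qbar_def Y_def \<sigma>_eq)

lemma p_measurable [measurable]: "i \<in> {1..n} \<Longrightarrow> p i \<in> borel_measurable borel"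
proof (rule borel_measurable_mono, rule monoI)
  fix s t :: real assume i: "i \<in> {1..n}" and st: "s \<le> t"
  show "p i s \<le> p i t"
    unfolding p_def using i \<sigma>_antimono[OF i st] by (intro finite_measure_mono) auto
qed

text \<open>A decreasing threshold makes \<open>qbar\<close> increasing, so its derivative is
  nonnegative almost everywhere and the truncation in \<open>h\<close> changes it on a null set
  only. Integrals over \<open>{0..t}\<close> therefore do not notice the replacement.\<close>

lemma
  assumes i: "i \<in> {1..n}"
  shows integrable_deriv_qbar: "integrable lborel (\<lambda>s. indicator {0..1} s * deriv (qbar M n v \<tau> i) s)"
    and AE_h: "AE s in lborel. h i s = indicator {0..1} s * deriv (qbar M n v \<tau> i) s"
    and qbar_eq_integral: "t \<in> {0..1} \<Longrightarrow> qbar M n v \<tau> i t = (LBINT s:{0..t}. h i s)"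
proof -
  let ?q = "qbar M n v \<tau> i"
  let ?d = "\<lambda>s. indicator {0..1} s * deriv ?q s"
  show int: "integrable lborel ?d"
    using deriv[OF i] by (simp add: integral_of_deriv_def set_integrable_def)
  then have [measurable]: "?d \<in> borel_measurable borel" by auto
  have q0: "?q 0 = 0"
    using surj[OF i] by (simp add: surjective_threshold_def)
  have q: "?q t = (LBINT s:{0..t}. ?d s)" if "t \<in> {0..1}" for t
  proof -
    have "?q t = (LBINT s:{0..t}. deriv ?q s)"
      using deriv[OF i] that q0 by (simp add: integral_of_deriv_def)
    also have "\<dots> = (LBINT s:{0..t}. ?d s)"
      using that by (intro set_lebesgue_integral_cong) auto
    finally show ?thesis .
  qed
  \<comment> \<open>The nonnegativity lemma asks for a primitive that is monotone on the whole line;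
    outside \<open>{0..1}\<close> this one is constant.\<close>
  have clamp: "(LBINT s:{0..t}. ?d s) = ?q (max 0 (min 1 t))" for t
  proof (cases "t < 0")
    case True
    then show ?thesis by (simp add: q0 set_lebesgue_integral_def)
  next
    case False
    have "(LBINT s:{0..t}. ?d s) = (LBINT s:{0..max 0 (min 1 t)}. ?d s)"
      unfolding set_lebesgue_integral_def
      by (rule Bochner_Integration.integral_cong) (use False in \<open>auto simp: indicator_def\<close>)
    then show ?thesis
      by (subst q) auto
  qed
  have "mono (\<lambda>t. LBINT s:{0..t}. ?d s)"
  proof (rule monoI)
    fix s t :: real assume st: "s \<le> t"
    have "\<sigma> i (max 0 (min 1 t)) \<le> \<sigma> i (max 0 (min 1 s))"
      using st by (intro \<sigma>_antimono[OF i]) auto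
    then show "(LBINT s:{0..s}. ?d s) \<le> (LBINT s:{0..t}. ?d s)"
      unfolding clamp by (subst (1 2) qbar_eq) (auto intro!: finite_measure_mono)
  qed
  then have "AE s in lborel. 0 \<le> ?d s"
    using int by (rule AE_nonneg_if_mono_primitive[where c=1, rotated 2]) auto
  then show AE: "AE s in lborel. h i s = ?d s"
    by eventually_elim (simp add: h_def)
  have [measurable]: "h i \<in> borel_measurable borel"
    unfolding h_def[abs_def] by measurable
  show "?q t = (LBINT s:{0..t}. h i s)" if "t \<in> {0..1}"
    unfolding q[OF that] set_lebesgue_integral_def
    by (rule integral_cong_AE) (use AE in auto)
qed

lemma h_nonneg: "0 \<le> h i s"
  by (simp add: h_def)

lemma h_outside: "s \<notin> {0..1} \<Longrightarrow> h i s = 0"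
  by (simp add: h_def)

lemma integrable_h: "i \<in> {1..n} \<Longrightarrow> integrable lborel (h i)"
  unfolding h_def[abs_def] by (intro integrable_max integrable_deriv_qbar) auto

lemma h_measurable [measurable]: "i \<in> {1..n} \<Longrightarrow> h i \<in> borel_measurable borel"
  using integrable_h by auto

lemma distr_Y:
  assumes i: "i \<in> {1..n}"
  shows "distr M borel (Y i) = distr (density lborel (\<lambda>s. ennreal (h i s))) borel (\<sigma> i)"
proof -
  have "distr (density lborel (\<lambda>s. ennreal (h i s * indicator {0..1} s))) borel (\<sigma> i) = distr M borel (Y i)"
  proof (rule distr_density_eq_of_antimono)
    show "finite_measure (distr M borel (Y i))"
      using prob_space_distr[of "Y i" borel] by (simp add: prob_space_def)
    have distr: "measure (distr M borel (Y i)) {\<sigma> i t<..} = qbar M n v \<tau> i t" if "t \<in> {0..1}" for t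
      using that by (subst measure_distr) (auto simp: qbar_eq vimage_def Int_def conj_commute)
    then show "measure (distr M borel (Y i)) {\<sigma> i t<..} = (LBINT s:{0..t}. h i s)" if "t \<in> {0..1}" for t
      using that qbar_eq_integral[OF i] by simp
    \<comment> \<open>Surjectivity at time 1: the competitor almost surely exceeds the final
      threshold, so \<open>h i\<close> accounts for the whole law of \<open>Y i\<close>.\<close>
    show "measure (distr M borel (Y i)) {\<sigma> i 1<..} = measure (distr M borel (Y i)) UNIV"
      using surj[OF i] by (subst distr) (auto simp: surjective_threshold_def measure_distr prob_space)
    show "antimono_on {0..1} (\<sigma> i)"
      using \<sigma>_antimono[OF i] by (auto simp: monotone_on_def)
    show "continuous_on {0..1} (\<sigma> i)"
      by (rule continuous_on_subset[OF continuous_\<sigma>[OF i]]) simp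
  qed (use i integrable_h h_nonneg in auto)
  moreover have "h i s * indicator {0..1} s = h i s" for s
    using h_outside[of s i] by (auto simp: indicator_def)
  ultimately show ?thesis by simp
qed

lemma indep_v: "indep_vars (\<lambda>_. borel) v {1..n}"
proof -
  have "indep_vars (\<lambda>j. PiM {Inl j} (\<lambda>_. borel))
      (\<lambda>j \<omega>. restrict (\<lambda>k. case_sum v T k \<omega>) {Inl j}) {1..n}"
    by (rule indep_vars_restrict[OF indep]) (auto simp: disjoint_family_on_def)
  from indep_vars_compose2[OF this, of "\<lambda>j f. f (Inl j)" "\<lambda>_. borel"]
  show ?thesis by simp
qed

lemma indep_v_Y:
  assumes i: "i \<in> {1..n}"
  shows "indep_var borel (Y i) borel (v i)"
proof -
  have "indep_var borel ((\<lambda>f. Max (f ` ({1..n} - {i}))) \<circ> (\<lambda>\<omega>. restrict (\<lambda>j. v j \<omega>) ({1..n} - {i})))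
      borel ((\<lambda>f. f i) \<circ> (\<lambda>\<omega>. restrict (\<lambda>j. v j \<omega>) {i}))"
    using i
    by (intro indep_var_compose[OF indep_var_restrict[OF indep_v]] borel_measurable_Max) auto
  then show ?thesis
    by (simp add: o_def Y_def[abs_def])
qed

text \<open>Condition on \<open>Y i\<close>, then replace it by \<open>\<sigma> i s\<close> with
  \<open>s\<close> of density \<open>h i\<close>. The identity as \<open>c\<close> turns the
  integral of \<open>p i * h i\<close> into the probability that item i is the strict maximum;
  \<open>max x\<close> as \<open>c\<close> adds the demand that its value exceeds
  \<open>x\<close>.\<close>

lemma emeasure_v_gt:
  assumes i: "i \<in> {1..n}" and [measurable]: "c \<in> borel_measurable borel"
  shows "emeasure M {\<omega>\<in>space M. c (Y i \<omega>) < v i \<omega>} =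
    (\<integral>\<^sup>+s. ennreal (h i s) * emeasure M {\<omega>\<in>space M. c (\<sigma> i s) < v i \<omega>} \<partial>lborel)"
proof -
  let ?\<psi> = "\<lambda>y. emeasure M {\<omega>\<in>space M. c y < v i \<omega>}"
  have [measurable]: "?\<psi> \<in> borel_measurable borel"
    using i by measurable
  have "emeasure M {\<omega>\<in>space M. c (Y i \<omega>) < v i \<omega>} = (\<integral>\<^sup>+y. ?\<psi> y \<partial>distr M borel (Y i))"
    by (rule emeasure_indep_var[OF indep_v_Y[OF i]]) measurable
  also have "\<dots> = (\<integral>\<^sup>+s. ennreal (h i s) * ?\<psi> (\<sigma> i s) \<partial>lborel)"
    using i unfolding distr_Y[OF i] by (simp add: nn_integral_distr nn_integral_density)
  finally show ?thesis .
qed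

lemma emeasure_v_eq_Y:
  assumes i: "i \<in> {1..n}"
  shows "emeasure M {\<omega>\<in>space M. v i \<omega> = Y i \<omega>} = 0"
  by (subst emeasure_indep_var[OF indep_v_Y[OF i], where R="\<lambda>y x. x = y"])
    (auto simp: prob_v_eq[OF i])

lemma sum_prob_v_gt_le:
  "(\<Sum>i\<in>{1..n}. prob {\<omega>\<in>space M. Y i \<omega> < v i \<omega>}) \<le> 1"
proof -
  have "disjoint_family_on (\<lambda>i. {\<omega>\<in>space M. Y i \<omega> < v i \<omega>}) {1..n}"
    unfolding disjoint_family_on_def
  proof safe
    fix i j \<omega> assume "i \<in> {1..n}" "j \<in> {1..n}" "i \<noteq> j" "Y i \<omega> < v i \<omega>" "Y j \<omega> < v j \<omega>"
    then have "v j \<omega> < v i \<omega>" "v i \<omega> < v j \<omega>"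
      using Y_less_iff[of i \<omega>] Y_less_iff[of j \<omega>] by auto
    then show "\<omega> \<in> {}" by simp
  qed
  then have "(\<Sum>i\<in>{1..n}. prob {\<omega>\<in>space M. Y i \<omega> < v i \<omega>}) = prob (\<Union>i\<in>{1..n}. {\<omega>\<in>space M. Y i \<omega> < v i \<omega>})"
    by (intro finite_measure_finite_Union[symmetric]) auto
  then show ?thesis by simp
qed

sublocale arrival_densities "{1..n}" h p \<Gamma>
proof
  have "(LBINT s. p i s * h i s) = prob {\<omega>\<in>space M. Y i \<omega> < v i \<omega>}" if i: "i \<in> {1..n}" for i
  proof -
    have "(\<integral>\<^sup>+s. ennreal (p i s * h i s) \<partial>lborel) = emeasure M {\<omega>\<in>space M. Y i \<omega> < v i \<omega>}"
      using emeasure_v_gt[OF i, of "\<lambda>y. y"]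
      by (auto simp: p_def h_nonneg ennreal_mult' emeasure_eq_measure mult_ac)
    then show ?thesis
      using i by (subst integral_eq_nn_integral) (auto simp: emeasure_eq_measure p_def h_nonneg)
  qed
  with sum_prob_v_gt_le show "(\<Sum>i\<in>{1..n}. LBINT s. p i s * h i s) \<le> 1"
    by simp
qed (auto simp: Gamma integrable_h h_nonneg p_def prob_le_1, measurable)

(* Otherwise simp rewrites {1..n} inside g and E, which then no longer match their lemmas. *)
declare One_nat_def [simp del]

section \<open>Law of the arrival times and the probability of being selected\<close>

definition F :: "nat \<Rightarrow> real \<Rightarrow> real" where
  "F i t = \<Gamma> * (h i t / g t) * E i t"

lemma F_measurable [measurable]: "i \<in> {1..n} \<Longrightarrow> F i \<in> borel_measurable borel"
  unfolding F_def[abs_def] by measurable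

lemma F_nonneg: "0 \<le> F i t"
  using Gamma h_nonneg[of i t] g_pos[of t] E_pos[of i t] by (simp add: F_def)

text \<open>One rule for the integrals inside both \<open>gbar\<close> and \<open>fbar\<close>: the
  weight is exchanged pointwise on \<open>{0..t}\<close>, the derivative almost everywhere.\<close>

lemma set_integral_deriv_qbar:
  assumes i: "i \<in> {1..n}" and t: "t \<in> {0..1}" and [measurable]: "w \<in> borel_measurable borel"
    and w: "\<And>s. s \<in> {0..t} \<Longrightarrow> w' s = w s"
  shows "(LBINT s:{0..t}. w' s * deriv (qbar M n v \<tau> i) s) = (LBINT s:{0..t}. w s * h i s)"
proof -
  let ?d = "\<lambda>s. indicator {0..1} s * deriv (qbar M n v \<tau> i) s"
  have [measurable]: "?d \<in> borel_measurable borel"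
    using integrable_deriv_qbar[OF i] by auto
  have "(LBINT s:{0..t}. w' s * deriv (qbar M n v \<tau> i) s) = (LBINT s:{0..t}. w s * ?d s)"
    using t w by (intro set_lebesgue_integral_cong) auto
  also have "\<dots> = (LBINT s:{0..t}. w s * h i s)"
    unfolding set_lebesgue_integral_def
  proof (rule integral_cong_AE)
    show "AE s in lborel. indicat_real {0..t} s *\<^sub>R (w s * ?d s) = indicat_real {0..t} s *\<^sub>R (w s * h i s)"
      using AE_h[OF i] by eventually_elim simp
  qed (use i in measurable)
  finally show ?thesis .
qed

lemma gbar_eq:
  assumes t: "t \<in> {0..1}"
  shows "gbar M n v \<tau> \<Gamma> t = g t"
proof -
  have "(LBINT s:{0..t}. pbar M v \<tau> i s * deriv (qbar M n v \<tau> i) s) = (LBINT s:{0..t}. p i s * h i s)"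
    if "i \<in> {1..n}" for i
    using that t by (intro set_integral_deriv_qbar) (auto simp: pbar_eq)
  then show ?thesis
    by (simp add: gbar_def g_def)
qed

text \<open>The denominator and the exponent agree at every time in \<open>{0..1}\<close>. Only the
  explicit factor \<open>deriv\<close> restricts the equality to almost every \<open>t\<close>,
  which suffices for a density.\<close>

lemma AE_fbar_eq:
  assumes i: "i \<in> {1..n}"
  shows "AE t in lborel. t \<in> {0..1} \<longrightarrow> fbar M n v \<tau> \<Gamma> i t = F i t"
  using AE_h[OF i]
proof eventually_elim
  fix t assume h: "h i t = indicator {0..1} t * deriv (qbar M n v \<tau> i) t"
  show "t \<in> {0..1} \<longrightarrow> fbar M n v \<tau> \<Gamma> i t = F i t"
  proof
    assume t: "t \<in> {0..1}"
    have "(LBINT s:{0..t}. deriv (qbar M n v \<tau> i) s * pbar M v \<tau> i s / gbar M n v \<tau> \<Gamma> s) =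
        (LBINT s:{0..t}. pbar M v \<tau> i s / gbar M n v \<tau> \<Gamma> s * deriv (qbar M n v \<tau> i) s)"
      by (simp add: mult_ac)
    also have "\<dots> = (LBINT s:{0..t}. p i s / g s * h i s)"
      using t i by (intro set_integral_deriv_qbar) (auto simp: pbar_eq gbar_eq)
    also have "\<dots> = (LBINT s:{0..t}. h i s * p i s / g s)"
      by (simp add: mult_ac)
    finally show "fbar M n v \<tau> \<Gamma> i t = F i t"
      using t h by (simp add: fbar_def F_def E_def gbar_eq)
  qed
qed

text \<open>The law of \<open>T i\<close> has an unspecified atom at 1. A function that vanishes
  from 1 on does not see it, so both measures are cut to times before 1, where they coincide set by
  set.\<close>

lemma nn_integral_T:
  assumes i: "i \<in> {1..n}" and [measurable]: "\<psi> \<in> borel_measurable borel"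
    and \<psi>: "\<And>t. t \<ge> 1 \<Longrightarrow> \<psi> t = 0"
  shows "(\<integral>\<^sup>+t. \<psi> t \<partial>distr M borel (T i)) = (\<integral>\<^sup>+t\<in>{0..<1}. ennreal (F i t) * \<psi> t \<partial>lborel)"
proof -
  have "density (distr M borel (T i)) (indicator {..<1}) = density lborel (\<lambda>t. ennreal (F i t) * indicator {0..<1} t)"
    (is "?L = ?R")
  proof (rule measure_eqI)
    fix B assume "B \<in> sets ?L"
    then have B [measurable]: "B \<in> sets borel" by simp
    have "emeasure ?L B = emeasure (distr M borel (T i)) (B \<inter> {..<1})"
      by (subst emeasure_density) (auto simp: mult.commute simp flip: indicator_inter_arith)
    also have "\<dots> = emeasure M {\<omega>\<in>space M. T i \<omega> \<in> B \<inter> {..<1}}"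
      using i by (subst emeasure_distr) (auto simp: vimage_def Int_def conj_commute intro!: arg_cong[where f="emeasure M"])
    also have "\<dots> = (\<integral>\<^sup>+t\<in>(B \<inter> {..<1}) \<inter> {0..<1}. ennreal (fbar M n v \<tau> \<Gamma> i t) \<partial>lborel)"
      using law[OF i] B unfolding has_arrival_law_def by (auto dest!: bspec[of _ _ "B \<inter> {..<1}"])
    also have "\<dots> = (\<integral>\<^sup>+t. (ennreal (F i t) * indicator {0..<1} t) * indicator B t \<partial>lborel)"
      by (rule nn_integral_cong_AE, rule AE_mp[OF AE_fbar_eq[OF i]])
        (auto intro!: AE_I2 simp: indicator_def)
    also have "\<dots> = emeasure ?R B"
      using i by (subst emeasure_density) auto
    finally show "emeasure ?L B = emeasure ?R B" .
  qed simp
  then have eq: "integral\<^sup>N ?L \<psi> = integral\<^sup>N ?R \<psi>" by simp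
  have "integral\<^sup>N ?L \<psi> = (\<integral>\<^sup>+t. \<psi> t \<partial>distr M borel (T i))"
    by (subst nn_integral_density) (auto intro!: nn_integral_cong simp: indicator_def \<psi>)
  moreover have "integral\<^sup>N ?R \<psi> = (\<integral>\<^sup>+t\<in>{0..<1}. ennreal (F i t) * \<psi> t \<partial>lborel)"
    using i by (subst nn_integral_density) (auto intro!: nn_integral_cong simp: mult_ac)
  ultimately show ?thesis using eq by simp
qed

text \<open>Conditioning on the arrival time of item i, with the event depending otherwise on a
  block \<open>J\<close> of variables. The block may contain the value of item i itself, which is
  independent of its arrival time.\<close>

lemma emeasure_T_others:
  assumes i: "i \<in> {1..n}" and J: "Inr i \<notin> J" "J \<subseteq> {1..n} <+> {1..n}"
    and R: "Measurable.pred (borel \<Otimes>\<^sub>M PiM J (\<lambda>_. borel)) (\<lambda>z. R (fst z) (snd z))"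
  shows "emeasure M {\<omega>\<in>space M. R (T i \<omega>) (restrict (\<lambda>k. case_sum v T k \<omega>) J)} =
    (\<integral>\<^sup>+u. emeasure M {\<omega>\<in>space M. R u (restrict (\<lambda>k. case_sum v T k \<omega>) J)} \<partial>distr M borel (T i))"
proof -
  let ?X = "\<lambda>J \<omega>. restrict (\<lambda>k. case_sum v T k \<omega>) J"
  let ?P = "\<lambda>J. PiM J (\<lambda>_::nat + nat. borel :: real measure)"
  let ?e = "\<lambda>u. emeasure M {\<omega>\<in>space M. R u (?X J \<omega>)}"
  have ind: "indep_var (?P {Inr i}) (?X {Inr i}) (?P J) (?X J)"
    using i J by (intro indep_var_restrict[OF indep]) auto
  note [measurable] = indep_var_rv1[OF ind] indep_var_rv2[OF ind]
  have "Measurable.pred (borel \<Otimes>\<^sub>M M) (\<lambda>z. R (fst z) (?X J (snd z)))"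
    using measurable_compose[OF _ R, of "\<lambda>z. (fst z, ?X J (snd z))" "borel \<Otimes>\<^sub>M M"] by simp
  then have [measurable]: "?e \<in> borel_measurable borel"
    by measurable
  have "emeasure M {\<omega>\<in>space M. R (?X {Inr i} \<omega> (Inr i)) (?X J \<omega>)} =
    (\<integral>\<^sup>+f. ?e (f (Inr i)) \<partial>distr M (?P {Inr i}) (?X {Inr i}))"
  proof (rule emeasure_indep_var[OF ind, where R="\<lambda>f. R (f (Inr i))"])
    show "Measurable.pred (?P {Inr i} \<Otimes>\<^sub>M ?P J) (\<lambda>z. R (fst z (Inr i)) (snd z))"
      using measurable_compose[OF _ R, of "\<lambda>z. (fst z (Inr i), snd z)" "?P {Inr i} \<Otimes>\<^sub>M ?P J"]
      by simp
  qed
  also have "\<dots> = (\<integral>\<^sup>+u. ?e u \<partial>distr M borel (T i))"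
    using i by (simp add: nn_integral_distr)
  finally show ?thesis by simp
qed

lemma prob_acceptable_before:
  assumes i: "i \<in> {1..n}" and t: "t \<in> {0..<1}"
  shows "prob {\<omega>\<in>space M. T i \<omega> \<le> t \<and> \<sigma> i (T i \<omega>) < v i \<omega>} = 1 - E i t"
proof -
  have J: "{Inl i} \<subseteq> {1..n} <+> {1..n}"
    using i by (auto simp del: atLeastAtMost_iff)
  have "Measurable.pred (borel \<Otimes>\<^sub>M PiM {Inl i} (\<lambda>_::nat + nat. borel))
      (\<lambda>z. fst z \<le> t \<and> \<sigma> i (fst z) < snd z (Inl i))"
    using i by measurable
  then have "emeasure M {\<omega>\<in>space M. T i \<omega> \<le> t \<and> \<sigma> i (T i \<omega>) < v i \<omega>} =
      (\<integral>\<^sup>+u. emeasure M {\<omega>\<in>space M. u \<le> t \<and> \<sigma> i u < v i \<omega>} \<partial>distr M borel (T i))"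
    using emeasure_T_others[OF i _ J, of "\<lambda>u w. u \<le> t \<and> \<sigma> i u < w (Inl i)"] by simp
  \<comment> \<open>Because \<open>t < 1\<close>, the event is empty for \<open>u \<ge> 1\<close>,
    and the atom at time 1 contributes nothing.\<close>
  also have "\<dots> = (\<integral>\<^sup>+u\<in>{0..<1}. ennreal (F i u) * emeasure M {\<omega>\<in>space M. u \<le> t \<and> \<sigma> i u < v i \<omega>} \<partial>lborel)"
    using i t by (intro nn_integral_T) (auto, measurable)
  also have "\<dots> = (\<integral>\<^sup>+u. ennreal (indicator {0..t} u * (F i u * p i u)) \<partial>lborel)"
    using t by (intro nn_integral_cong)
      (auto simp: indicator_def p_def emeasure_eq_measure ennreal_mult' F_nonneg)
  finally have "ennreal (prob {\<omega>\<in>space M. T i \<omega> \<le> t \<and> \<sigma> i (T i \<omega>) < v i \<omega>}) =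
      (\<integral>\<^sup>+u. ennreal (indicator {0..t} u * (F i u * p i u)) \<partial>lborel)"
    by (simp add: emeasure_eq_measure)
  from arg_cong[OF this, of enn2real] have "prob {\<omega>\<in>space M. T i \<omega> \<le> t \<and> \<sigma> i (T i \<omega>) < v i \<omega>} =
      enn2real (\<integral>\<^sup>+u. ennreal (indicator {0..t} u * (F i u * p i u)) \<partial>lborel)"
    by (simp only: enn2real_ennreal[OF measure_nonneg])
  also have "\<dots> = (LBINT u:{0..t}. F i u * p i u)"
    unfolding set_lebesgue_integral_def real_scaleR_def
    using i by (subst integral_eq_nn_integral) (auto simp: F_nonneg p_def)
  also have "\<dots> = 1 - E i t"
    using integral_density_E[OF i, of t] t by (simp add: F_def)
  finally show ?thesis .
qed

text \<open>With the time \<open>u\<close> frozen, the condition on item i and the condition on each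
  competitor j involve disjoint blocks, each consisting of one value and one arrival time, so the
  probabilities multiply.\<close>

lemma prob_selected_at:
  assumes i: "i \<in> {1..n}" and u: "u \<in> {0..<1}"
  shows "emeasure M {\<omega>\<in>space M. c < v i \<omega> \<and> (\<forall>j\<in>{1..n}-{i}. \<not> (T j \<omega> \<le> u \<and> \<sigma> j (T j \<omega>) < v j \<omega>))} =
    emeasure M {\<omega>\<in>space M. c < v i \<omega>} * ennreal (\<Prod>j\<in>{1..n}-{i}. E j u)"
proof -
  let ?K = "\<lambda>j. {Inl j, Inr j :: nat + nat}"
  let ?Z = "\<lambda>j \<omega>. restrict (\<lambda>k. case_sum v T k \<omega>) (?K j)"
  let ?R = "\<lambda>j w. if j = i then c < w (Inl i) else \<not> (w (Inr j) \<le> u \<and> \<sigma> j (w (Inr j)) < w (Inl j))"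
  have ind: "indep_vars (\<lambda>j. PiM (?K j) (\<lambda>_. borel)) ?Z {1..n}"
    by (rule indep_vars_restrict[OF indep]) (auto simp: disjoint_family_on_def)
  have meas: "{w\<in>space (PiM (?K j) (\<lambda>_. borel)). ?R j w} \<in> sets (PiM (?K j) (\<lambda>_. borel))"
    if "j \<in> {1..n}" for j
    using that i by (cases "j = i") auto
  have events: "indep_events (\<lambda>j. {\<omega>\<in>space M. ?R j (?Z j \<omega>)}) {1..n}"
    by (rule indep_eventsI_indep_vars[OF ind meas])
  have "prob (\<Inter>j\<in>{1..n}. {\<omega>\<in>space M. ?R j (?Z j \<omega>)}) = (\<Prod>j\<in>{1..n}. prob {\<omega>\<in>space M. ?R j (?Z j \<omega>)})"
    using i events unfolding indep_events_def by auto
  also have "(\<Inter>j\<in>{1..n}. {\<omega>\<in>space M. ?R j (?Z j \<omega>)}) =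
      {\<omega>\<in>space M. c < v i \<omega> \<and> (\<forall>j\<in>{1..n}-{i}. \<not> (T j \<omega> \<le> u \<and> \<sigma> j (T j \<omega>) < v j \<omega>))}"
    using i by (fastforce split: if_splits)
  also have "(\<Prod>j\<in>{1..n}. prob {\<omega>\<in>space M. ?R j (?Z j \<omega>)}) =
      prob {\<omega>\<in>space M. c < v i \<omega>} * (\<Prod>j\<in>{1..n}-{i}. prob {\<omega>\<in>space M. ?R j (?Z j \<omega>)})"
    using i by (subst prod.remove[of _ i]) auto
  also have "(\<Prod>j\<in>{1..n}-{i}. prob {\<omega>\<in>space M. ?R j (?Z j \<omega>)}) = (\<Prod>j\<in>{1..n}-{i}. E j u)"
  proof (rule prod.cong[OF refl])
    fix j assume j: "j \<in> {1..n}-{i}"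
    let ?A = "{\<omega>\<in>space M. T j \<omega> \<le> u \<and> \<sigma> j (T j \<omega>) < v j \<omega>}"
    have "{\<omega>\<in>space M. ?R j (?Z j \<omega>)} = space M - ?A"
      using j by auto
    moreover have "j \<in> {1..n}"
      using j by simp
    then have "?A \<in> events"
      by measurable
    ultimately show "prob {\<omega>\<in>space M. ?R j (?Z j \<omega>)} = E j u"
      using prob_acceptable_before[of j u] j u by (simp add: prob_compl)
  qed
  finally show ?thesis
    by (simp add: emeasure_eq_measure ennreal_mult' prod_nonneg less_imp_le[OF E_pos])
qed

text \<open>Ties in arrival time count against item i. This makes the events disjoint and places
  them inside the event for \<open>ALG\<close> whatever its tie rule, and one inclusion is enough
  for a lower bound. Under \<open>T i \<omega> < 1\<close> a competitor with
  \<open>T j \<omega> \<le> T i \<omega>\<close> also arrives before 1, so the inner condition is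
  exactly being acceptable.\<close>

definition selected :: "real \<Rightarrow> nat \<Rightarrow> 'a set" where
  "selected x i = {\<omega>\<in>space M. T i \<omega> < 1 \<and> max x (\<sigma> i (T i \<omega>)) < v i \<omega> \<and>
     (\<forall>j\<in>{1..n}-{i}. \<not> (T j \<omega> \<le> T i \<omega> \<and> \<sigma> j (T j \<omega>) < v j \<omega>))}"

lemma selected_in_events:
  assumes i: "i \<in> {1..n}"
  shows "selected x i \<in> events"
proof -
  have C: "Measurable.pred M (\<lambda>\<omega>. \<not> (T j \<omega> \<le> T i \<omega> \<and> \<sigma> j (T j \<omega>) < v j \<omega>))"
    if "j \<in> {1..n} - {i}" for j
  proof -
    from that have "j \<in> {1..n}" by simp
    with i show ?thesis by measurable
  qed
  have [measurable]: "Measurable.pred M (\<lambda>\<omega>. \<forall>j\<in>{1..n}-{i}. \<not> (T j \<omega> \<le> T i \<omega> \<and> \<sigma> j (T j \<omega>) < v j \<omega>))"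
    by (intro pred_intros_finite(3) C) simp
  show ?thesis
    using i unfolding selected_def by measurable
qed

text \<open>The arguments are arbitrary measurable functions, so that the rule serves both for
  coordinates of a product space and for the random variables themselves.\<close>

lemma pred_not_acceptable_before:
  assumes "j \<in> {1..n}" and [measurable]: "a \<in> borel_measurable N" "b \<in> borel_measurable N" "c \<in> borel_measurable N"
  shows "Measurable.pred N (\<lambda>z. \<not> (b z \<le> a z \<and> \<sigma> j (b z) < c z))"
  using assms(1) by measurable

lemma pred_acceptable:
  assumes "i \<in> {1..n}" and [measurable]: "a \<in> borel_measurable N" "c \<in> borel_measurable N" "Measurable.pred N Q"
  shows "Measurable.pred N (\<lambda>z. a z < 1 \<and> max x (\<sigma> i (a z)) < c z \<and> Q z)"
  using assms(1) by measurable

lemma emeasure_selected: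
  assumes i: "i \<in> {1..n}"
  shows "emeasure M (selected x i) = ennreal \<Gamma> * emeasure M {\<omega>\<in>space M. max x (Y i \<omega>) < v i \<omega>}"
proof -
  let ?J = "({1..n} <+> {1..n}) - {Inr i :: nat + nat}"
  let ?W = "\<lambda>\<omega>. restrict (\<lambda>k. case_sum v T k \<omega>) ?J"
  let ?R = "\<lambda>u w. u < 1 \<and> max x (\<sigma> i u) < w (Inl i) \<and>
     (\<forall>j\<in>{1..n}-{i}. \<not> (w (Inr j) \<le> u \<and> \<sigma> j (w (Inr j)) < w (Inl j)))"
  have R: "Measurable.pred (borel \<Otimes>\<^sub>M PiM ?J (\<lambda>_. borel)) (\<lambda>z. ?R (fst z) (snd z))"
  proof -
    let ?N = "borel \<Otimes>\<^sub>M PiM ?J (\<lambda>_. borel :: real measure)"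
    have component: "(\<lambda>z. snd z k) \<in> borel_measurable ?N" if "k \<in> ?J" for k
      by (rule measurable_compose[OF measurable_snd measurable_component_singleton[OF that]])
    have "Measurable.pred ?N (\<lambda>z. \<not> (snd z (Inr j) \<le> fst z \<and> \<sigma> j (snd z (Inr j)) < snd z (Inl j)))"
      if "j \<in> {1..n} - {i}" for j
      using that by (intro pred_not_acceptable_before component measurable_fst) auto
    then have "Measurable.pred ?N
        (\<lambda>z. \<forall>j\<in>{1..n}-{i}. \<not> (snd z (Inr j) \<le> fst z \<and> \<sigma> j (snd z (Inr j)) < snd z (Inl j)))"
      by (rule pred_intros_finite(3)[OF finite_Diff[OF finite_atLeastAtMost]])
    then show ?thesis
      using i by (intro pred_acceptable component measurable_fst) auto
  qed
  \<comment> \<open>The same event in terms of random variables: \<open>?R\<close> reads coordinates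
    of the block, as conditioning requires, while \<open>?S\<close> is what gets evaluated.\<close>
  let ?S = "\<lambda>u \<omega>. u < 1 \<and> max x (\<sigma> i u) < v i \<omega> \<and>
     (\<forall>j\<in>{1..n}-{i}. \<not> (T j \<omega> \<le> u \<and> \<sigma> j (T j \<omega>) < v j \<omega>))"
  have S: "?R u (?W \<omega>) = ?S u \<omega>" for u \<omega>
    using i by auto
  have "Measurable.pred (borel \<Otimes>\<^sub>M M) (\<lambda>z. \<not> (T j (snd z) \<le> fst z \<and> \<sigma> j (T j (snd z)) < v j (snd z)))"
    if "j \<in> {1..n} - {i}" for j
    using that by (intro pred_not_acceptable_before measurable_fst
      measurable_compose[OF measurable_snd T_measurable] measurable_compose[OF measurable_snd v_measurable]) auto
  then have "Measurable.pred (borel \<Otimes>\<^sub>M M)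
      (\<lambda>z. \<forall>j\<in>{1..n}-{i}. \<not> (T j (snd z) \<le> fst z \<and> \<sigma> j (T j (snd z)) < v j (snd z)))"
    by (rule pred_intros_finite(3)[OF finite_Diff[OF finite_atLeastAtMost]])
  then have "Measurable.pred (borel \<Otimes>\<^sub>M M) (\<lambda>z. ?S (fst z) (snd z))"
    using i by (intro pred_acceptable measurable_fst measurable_compose[OF measurable_snd v_measurable]) auto
  then have S_measurable: "(\<lambda>u. emeasure M {\<omega>\<in>space M. ?S u \<omega>}) \<in> borel_measurable borel"
    by measurable
  have J: "Inr i \<notin> ?J" "?J \<subseteq> {1..n} <+> {1..n}"
    by blast+
  have "selected x i = {\<omega>\<in>space M. ?S (T i \<omega>) \<omega>}"
    by (simp only: selected_def)
  then have "emeasure M (selected x i) = (\<integral>\<^sup>+u. emeasure M {\<omega>\<in>space M. ?S u \<omega>} \<partial>distr M borel (T i))"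
    using emeasure_T_others[OF i J R] by (simp only: S)
  also have "\<dots> = (\<integral>\<^sup>+u\<in>{0..<1}. ennreal (F i u) * emeasure M {\<omega>\<in>space M. ?S u \<omega>} \<partial>lborel)"
    by (rule nn_integral_T[OF i S_measurable]) simp
  also have "\<dots> = (\<integral>\<^sup>+u. ennreal \<Gamma> * (ennreal (h i u) * emeasure M {\<omega>\<in>space M. max x (\<sigma> i u) < v i \<omega>}) \<partial>lborel)"
  \<comment> \<open>The point 1 is set aside because \<open>h i\<close> may be nonzero there,
    whereas arrivals at time 1 are excluded on the left.\<close>
  proof (rule nn_integral_cong_AE, rule AE_mp[OF AE_lborel_singleton[of 1]], rule AE_I2, rule impI)
    fix u :: real assume "u \<noteq> 1"
    show "ennreal (F i u) * emeasure M {\<omega>\<in>space M. ?S u \<omega>} * indicator {0..<1} u =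
      ennreal \<Gamma> * (ennreal (h i u) * emeasure M {\<omega>\<in>space M. max x (\<sigma> i u) < v i \<omega>})"
    proof (cases "u \<in> {0..<1}")
      case True
      have eqS: "{\<omega>\<in>space M. ?S u \<omega>} = {\<omega>\<in>space M. max x (\<sigma> i u) < v i \<omega> \<and>
          (\<forall>j\<in>{1..n}-{i}. \<not> (T j \<omega> \<le> u \<and> \<sigma> j (T j \<omega>) < v j \<omega>))}"
        using True by simp
      \<comment> \<open>This is the cancellation for which \<open>F\<close> was designed: its factor
        \<open>E i u\<close> completes the product over the competitors to \<open>g u\<close>, its
        denominator.\<close>
      have "E i u * (\<Prod>j\<in>{1..n}-{i}. E j u) = g u"
        using prod_E[of u] prod.remove[of "{1..n}" i "\<lambda>j. E j u"] i True by simp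
      then have "F i u * (\<Prod>j\<in>{1..n}-{i}. E j u) = \<Gamma> * h i u"
        using g_pos[of u] by (simp add: F_def mult.assoc)
      then have eqF: "ennreal (F i u) * ennreal (\<Prod>j\<in>{1..n}-{i}. E j u) = ennreal \<Gamma> * ennreal (h i u)"
        using Gamma h_nonneg[of i u] F_nonneg[of i u] by (simp flip: ennreal_mult')
      let ?Q = "emeasure M {\<omega>\<in>space M. max x (\<sigma> i u) < v i \<omega>}"
      have "ennreal (F i u) * emeasure M {\<omega>\<in>space M. ?S u \<omega>} =
          ennreal (F i u) * (?Q * ennreal (\<Prod>j\<in>{1..n}-{i}. E j u))"
        by (simp only: eqS prob_selected_at[OF i True])
      also have "\<dots> = ennreal (F i u) * ennreal (\<Prod>j\<in>{1..n}-{i}. E j u) * ?Q"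
        by (simp only: mult_ac)
      also have "\<dots> = ennreal \<Gamma> * (ennreal (h i u) * ?Q)"
        by (simp only: eqF mult.assoc)
      finally show ?thesis
        using True by simp
    next
      case False
      then show ?thesis
        using h_outside[of u i] \<open>u \<noteq> 1\<close> by (auto simp: indicator_def)
    qed
  qed
  also have "\<dots> = ennreal \<Gamma> * (\<integral>\<^sup>+u. ennreal (h i u) * emeasure M {\<omega>\<in>space M. max x (\<sigma> i u) < v i \<omega>} \<partial>lborel)"
    using i by (intro nn_integral_cmult) measurable
  \<comment> \<open>Read backwards, the conditioning on \<open>Y i\<close> turns the integral over
    time into a comparison with the strongest competitor.\<close>
  also have "(\<integral>\<^sup>+u. ennreal (h i u) * emeasure M {\<omega>\<in>space M. max x (\<sigma> i u) < v i \<omega>} \<partial>lborel) =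
      emeasure M {\<omega>\<in>space M. max x (Y i \<omega>) < v i \<omega>}"
    by (rule emeasure_v_gt[OF i, symmetric]) simp
  finally show ?thesis .
qed

section \<open>The outcome of \<open>ALG\<close> and the comparison with the maximum\<close>

lemma acceptable_iff:
  assumes "\<omega> \<in> space M"
  shows "i \<in> acceptable n \<tau> (\<lambda>i. v i \<omega>) (\<lambda>i. T i \<omega>) \<longleftrightarrow>
    i \<in> {1..n} \<and> T i \<omega> < 1 \<and> \<sigma> i (T i \<omega>) < v i \<omega>"
  using T_range[OF _ assms, of i] \<sigma>_eq[of "T i \<omega>" i] by (auto simp: acceptable_def)

text \<open>The accepted item is the lexicographic minimum of arrival time and index; expressing
  this by finite quantifiers instead of \<open>LEAST\<close> makes the event visibly measurable.
  Positivity of \<open>x\<close> rules out the default value 0 of \<open>ALG\<close>.\<close>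

lemma ALG_gt_iff:
  assumes \<omega>: "\<omega> \<in> space M" and "0 < x"
  shows "x < ALG n \<tau> (\<lambda>i. v i \<omega>) (\<lambda>i. T i \<omega>) \<longleftrightarrow>
    (\<exists>i\<in>{1..n}. T i \<omega> < 1 \<and> \<sigma> i (T i \<omega>) < v i \<omega> \<and> x < v i \<omega> \<and>
      (\<forall>j\<in>{1..n}. T j \<omega> < 1 \<and> \<sigma> j (T j \<omega>) < v j \<omega> \<longrightarrow>
        T i \<omega> \<le> T j \<omega> \<and> (j < i \<longrightarrow> T i \<omega> < T j \<omega>)))"
    (is "_ \<longleftrightarrow> ?R")
proof -
  let ?A = "acceptable n \<tau> (\<lambda>i. v i \<omega>) (\<lambda>i. T i \<omega>)"
  let ?P = "\<lambda>i. i \<in> ?A \<and> (\<forall>j\<in>?A. T i \<omega> \<le> T j \<omega>)"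
  have R: "?R \<longleftrightarrow> (\<exists>i\<in>?A. x < v i \<omega> \<and> (\<forall>j\<in>?A. T i \<omega> \<le> T j \<omega> \<and> (j < i \<longrightarrow> T i \<omega> < T j \<omega>)))"
    unfolding Bex_def Ball_def acceptable_iff[OF \<omega>] by blast
  show ?thesis
    unfolding R
  proof
    assume gt: "x < ALG n \<tau> (\<lambda>i. v i \<omega>) (\<lambda>i. T i \<omega>)"
    then have ne: "?A \<noteq> {}"
      using \<open>0 < x\<close> by (auto simp: ALG_def)
    have "finite ?A"
      by (simp add: acceptable_def)
    then have "?P (arg_min_on (\<lambda>i. T i \<omega>) ?A)"
      using ne arg_min_if_finite[of ?A "\<lambda>i. T i \<omega>"] by (auto simp: not_less)
    then have least: "?P (LEAST i. ?P i)"
      by (rule LeastI)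
    have "T (LEAST i. ?P i) \<omega> < T j \<omega>" if "j \<in> ?A" "j < (LEAST i. ?P i)" for j
    proof (rule ccontr)
      assume "\<not> T (LEAST i. ?P i) \<omega> < T j \<omega>"
      \<comment> \<open>Arriving no later than an earliest acceptable item makes \<open>j\<close>
        itself earliest, against the choice of the least index.\<close>
      then have "?P j"
        using least that(1) by force
      then show False
        using not_less_Least[OF that(2)] by simp
    qed
    moreover have "x < v (LEAST i. ?P i) \<omega>"
      using gt ne by (simp add: ALG_def)
    ultimately show "\<exists>i\<in>?A. x < v i \<omega> \<and> (\<forall>j\<in>?A. T i \<omega> \<le> T j \<omega> \<and> (j < i \<longrightarrow> T i \<omega> < T j \<omega>))"
      using least by blast
  next
    assume "\<exists>i\<in>?A. x < v i \<omega> \<and> (\<forall>j\<in>?A. T i \<omega> \<le> T j \<omega> \<and> (j < i \<longrightarrow> T i \<omega> < T j \<omega>))"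
    then obtain i where i: "i \<in> ?A" "x < v i \<omega>" "\<forall>j\<in>?A. T i \<omega> \<le> T j \<omega> \<and> (j < i \<longrightarrow> T i \<omega> < T j \<omega>)"
      by blast
    then have "(LEAST i. ?P i) = i"
      by (intro Least_equality) (auto simp: not_less[symmetric])
    then show "x < ALG n \<tau> (\<lambda>i. v i \<omega>) (\<lambda>i. T i \<omega>)"
      using i by (auto simp: ALG_def)
  qed
qed

lemma ALG_gt_in_events:
  assumes "0 < x"
  shows "{\<omega>\<in>space M. x < ALG n \<tau> (\<lambda>i. v i \<omega>) (\<lambda>i. T i \<omega>)} \<in> events"
proof -
  let ?C = "\<lambda>i j \<omega>. T j \<omega> < 1 \<and> \<sigma> j (T j \<omega>) < v j \<omega> \<longrightarrow>
    T i \<omega> \<le> T j \<omega> \<and> (j < i \<longrightarrow> T i \<omega> < T j \<omega>)"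
  let ?B = "\<lambda>i \<omega>. T i \<omega> < 1 \<and> \<sigma> i (T i \<omega>) < v i \<omega> \<and> x < v i \<omega>"
  have C: "Measurable.pred M (?C i j)" if "i \<in> {1..n}" "j \<in> {1..n}" for i j
    using that by measurable
  have B: "Measurable.pred M (?B i)" if "i \<in> {1..n}" for i
    using that by measurable
  have "Measurable.pred M (\<lambda>\<omega>. \<exists>i\<in>{1..n}. ?B i \<omega> \<and> (\<forall>j\<in>{1..n}. ?C i j \<omega>))"
    by (intro pred_intros_finite pred_intros_logic B C) auto
  moreover have "{\<omega>\<in>space M. x < ALG n \<tau> (\<lambda>i. v i \<omega>) (\<lambda>i. T i \<omega>)} =
      {\<omega>\<in>space M. \<exists>i\<in>{1..n}. ?B i \<omega> \<and> (\<forall>j\<in>{1..n}. ?C i j \<omega>)}"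
    by (rule Collect_cong, rule conj_cong[OF refl]) (simp only: ALG_gt_iff[OF _ assms] conj_assoc)
  ultimately show ?thesis
    by (simp only: pred_def)
qed

lemma selected_subset:
  assumes i: "i \<in> {1..n}" and "0 < x"
  shows "selected x i \<subseteq> {\<omega>\<in>space M. x < ALG n \<tau> (\<lambda>i. v i \<omega>) (\<lambda>i. T i \<omega>)}"
proof
  fix \<omega> assume \<omega>: "\<omega> \<in> selected x i"
  then have s: "\<omega> \<in> space M" "T i \<omega> < 1" "x < v i \<omega>" "\<sigma> i (T i \<omega>) < v i \<omega>"
    and before: "\<And>j. j \<in> {1..n} \<Longrightarrow> j \<noteq> i \<Longrightarrow> \<sigma> j (T j \<omega>) < v j \<omega> \<Longrightarrow> T i \<omega> < T j \<omega>"
    by (auto simp: selected_def not_le)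
  have "x < ALG n \<tau> (\<lambda>i. v i \<omega>) (\<lambda>i. T i \<omega>)"
    unfolding ALG_gt_iff[OF s(1) \<open>0 < x\<close>]
    by (rule bexI[OF _ i]) (use s before in \<open>force intro: less_imp_le\<close>)
  with s show "\<omega> \<in> {\<omega>\<in>space M. x < ALG n \<tau> (\<lambda>i. v i \<omega>) (\<lambda>i. T i \<omega>)}"
    by simp
qed

lemma disjoint_selected: "disjoint_family_on (selected x) {1..n}"
  unfolding disjoint_family_on_def
proof safe
  fix i j \<omega> assume ij: "i \<in> {1..n}" "j \<in> {1..n}" "i \<noteq> j" and "\<omega> \<in> selected x i" "\<omega> \<in> selected x j"
  then have "T i \<omega> < T j \<omega>" "T j \<omega> < T i \<omega>"
    unfolding selected_def by force+
  then show "\<omega> \<in> {}" by simp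
qed

text \<open>A union bound: an item attaining the maximum satisfies
  \<open>Y i \<omega> \<le> v i \<omega>\<close>, and equality is a null event because
  \<open>v i\<close> has a density and is independent of \<open>Y i\<close>.\<close>

lemma prob_max_le:
  "prob {\<omega>\<in>space M. x < Max ((\<lambda>i. v i \<omega>) ` {1..n})} \<le>
    (\<Sum>i\<in>{1..n}. prob {\<omega>\<in>space M. max x (Y i \<omega>) < v i \<omega>})"
proof -
  let ?A = "\<lambda>i. {\<omega>\<in>space M. max x (Y i \<omega>) < v i \<omega>}"
  let ?B = "\<lambda>i. {\<omega>\<in>space M. v i \<omega> = Y i \<omega>}"
  have A: "?A i \<in> events" and B: "?B i \<in> events" if "i \<in> {1..n}" for i
    using that by measurable
  have "{\<omega>\<in>space M. x < Max ((\<lambda>i. v i \<omega>) ` {1..n})} \<subseteq> (\<Union>i\<in>{1..n}. ?A i \<union> ?B i)"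
  proof
    fix \<omega> assume \<omega>: "\<omega> \<in> {\<omega>\<in>space M. x < Max ((\<lambda>i. v i \<omega>) ` {1..n})}"
    have "Max ((\<lambda>i. v i \<omega>) ` {1..n}) \<in> (\<lambda>i. v i \<omega>) ` {1..n}"
      using n by (intro Max_in) auto
    then obtain i where i: "i \<in> {1..n}" "v i \<omega> = Max ((\<lambda>i. v i \<omega>) ` {1..n})"
      by force
    have "Y i \<omega> \<le> v i \<omega>"
      unfolding Y_def i(2) using others_nonempty[of i] by (intro Max_mono) auto
    with \<omega> i show "\<omega> \<in> (\<Union>i\<in>{1..n}. ?A i \<union> ?B i)"
      by force
  qed
  then have "prob {\<omega>\<in>space M. x < Max ((\<lambda>i. v i \<omega>) ` {1..n})} \<le> prob (\<Union>i\<in>{1..n}. ?A i \<union> ?B i)"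
    using A B by (intro finite_measure_mono sets.finite_UN) auto
  also have "\<dots> \<le> (\<Sum>i\<in>{1..n}. prob (?A i \<union> ?B i))"
    using A B by (intro finite_measure_subadditive_finite) auto
  also have "\<dots> \<le> (\<Sum>i\<in>{1..n}. prob (?A i))"
  proof (rule sum_mono)
    fix i assume i: "i \<in> {1..n}"
    have "prob (?A i \<union> ?B i) \<le> prob (?A i) + prob (?B i)"
      using A[OF i] B[OF i] by (rule measure_Un_le)
    moreover have "prob (?B i) = 0"
      using emeasure_v_eq_Y[OF i] by (simp add: measure_def)
    ultimately show "prob (?A i \<union> ?B i) \<le> prob (?A i)" by simp
  qed
  finally show ?thesis .
qed

lemma prob_ALG_gt:
  assumes x: "0 < x"
  shows "\<Gamma> * prob {\<omega>\<in>space M. x < Max ((\<lambda>i. v i \<omega>) ` {1..n})} \<le>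
    prob {\<omega>\<in>space M. x < ALG n \<tau> (\<lambda>i. v i \<omega>) (\<lambda>i. T i \<omega>)}"
proof -
  have "\<Gamma> * prob {\<omega>\<in>space M. x < Max ((\<lambda>i. v i \<omega>) ` {1..n})} \<le>
      (\<Sum>i\<in>{1..n}. \<Gamma> * prob {\<omega>\<in>space M. max x (Y i \<omega>) < v i \<omega>})"
    using prob_max_le[of x] Gamma by (simp add: sum_distrib_left[symmetric])
  also have "\<dots> = (\<Sum>i\<in>{1..n}. prob (selected x i))"
  proof (rule sum.cong[OF refl])
    fix i assume "i \<in> {1..n}"
    from emeasure_selected[OF this, of x]
    show "\<Gamma> * prob {\<omega>\<in>space M. max x (Y i \<omega>) < v i \<omega>} = prob (selected x i)"
      using Gamma by (simp add: emeasure_eq_measure ennreal_mult'[symmetric])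
  qed
  also have "\<dots> = prob (\<Union>i\<in>{1..n}. selected x i)"
    by (rule finite_measure_finite_Union[symmetric])
      (use selected_in_events disjoint_selected in auto)
  also have "\<dots> \<le> prob {\<omega>\<in>space M. x < ALG n \<tau> (\<lambda>i. v i \<omega>) (\<lambda>i. T i \<omega>)}"
    using selected_subset[OF _ x] ALG_gt_in_events[OF x] by (intro finite_measure_mono) blast+
  finally show ?thesis .
qed

end

theorem theorem6:
  fixes M :: "'a measure" and n :: nat and v T :: "nat \<Rightarrow> 'a \<Rightarrow> real"
    and \<tau> :: "nat \<Rightarrow> real \<Rightarrow> real" and \<Gamma> x :: real
  assumes "prob_space M"
    and "n > 1"
    and "\<And>i. i \<in> {1..n} \<Longrightarrow> interval_density M (v i)"
    and "0 < \<Gamma>" "\<Gamma> < 1"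
    and "\<And>i. i \<in> {1..n} \<Longrightarrow> strict_antimono_on {0..1} (\<tau> i)"
    and "\<And>i. i \<in> {1..n} \<Longrightarrow> continuous_on {0..1} (\<tau> i)"
    and "\<And>i. i \<in> {1..n} \<Longrightarrow> surjective_threshold M n v \<tau> i"
    and "\<And>i. i \<in> {1..n} \<Longrightarrow> integral_of_deriv (qbar M n v \<tau> i)"
    and "\<And>i. i \<in> {1..n} \<Longrightarrow> (\<integral>\<^sup>+t\<in>{0..1}. ennreal (fbar M n v \<tau> \<Gamma> i t) \<partial>lborel) \<le> 1"
    and "\<And>i. i \<in> {1..n} \<Longrightarrow> has_arrival_law M (T i) (fbar M n v \<tau> \<Gamma> i)"
    and "prob_space.indep_vars M (\<lambda>_. borel) (case_sum v T) ({1..n} <+> {1..n})"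
    and "x > 0"
  shows "measure M {\<omega> \<in> space M. ALG n \<tau> (\<lambda>i. v i \<omega>) (\<lambda>i. T i \<omega>) > x}
           \<ge> \<Gamma> * measure M {\<omega> \<in> space M. Max ((\<lambda>i. v i \<omega>) ` {1..n}) > x}"
proof -
  interpret prob_space M by fact
  interpret order_selection M n v T \<tau> \<Gamma>
    by unfold_locales (use assms in auto)
  show ?thesis
    by (rule prob_ALG_gt) fact
qed

end
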